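(* Let $q=1$. Let $Z_1,Z_2,\ldots\in\mathbb{R}^d$ be i.i.d. with distribution $F$, $Z\sim F$. For each $\lambda\in\mathbb{R}$ let $\hat\theta(\lambda)\in\mathbb{R}^p$ be the unique solution to $n^{-1}\sum_{i=1}^n\varphi(Z_i,\theta,\lambda)=0$, let $\mathrm{TE}(\lambda)=n^{-1}\sum_{i=1}^n\psi\{Z_i,\hat\theta(\lambda)\}$, and let $\hat\lambda_G$ be the global minimizer of $\mathrm{TE}$ over $\mathbb{R}$, assumed to be the unique solution to $\mathrm{TE}'(\lambda)=o_p(1/\sqrt n)$. With $\eta$ and $\Psi(\alpha)=\mathrm{E}\,\eta(Z,\alpha)$ as in the context, assume that $\Psi(\alpha)=0$ has a unique solution $\alpha_0$, whose $\lambda$-component is denoted $\lambda_0$, that $\Psi$ is continuously differentiable in a neighbourhood of $\alpha_0$, that $\Psi'(\alpha_0)$ is non-singular, and that in a neighbourhood of $\alpha_0$ the norm of $\eta(z,\alpha)$ and all first order partial derivatives of $\eta$ with respect to $\alpha$ are bounded by functions $m_0(z)$ and $m_1(z)$, respectively, with $\mathrm{E}\,m_0(Z)^2,\mathrm{E}\,m_1(Z)^2<\infty$. Define the truncated estimator $$\hat\theta_T(\lambda)=\hat\theta(0)I(\lambda\le 0)+\hat\theta(\lambda)I(0<\lambda<1)+\hat\theta(1)I(\lambda\ge 1),$$ where $I$ is the indicator function. In each item below $\theta_0\in\mathbb{R}^p$ is the centring vector occurring in that item. The following hold as $n\to\infty$. (a) If $\hat\lambda_G\to\lambda_0<0$ in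 probability and $\sqrt n\{\hat\theta(0)-\theta_0\}\to N$ in distribution, where $N$ is a zero mean normal random vector, then $\hat\theta_T(\hat\lambda_G)\to\theta_0$ in probability and $\sqrt n\{\hat\theta_T(\hat\lambda_G)-\theta_0\}\to N$ in distribution. (b) If $\hat\lambda_G\to\lambda_0>1$ in probability and $\sqrt n\{\hat\theta(1)-\theta_0\}\to N$ in distribution, where $N$ is a zero mean normal random vector, then $\hat\theta_T(\hat\lambda_G)\to\theta_0$ in probability and $\sqrt n\{\hat\theta_T(\hat\lambda_G)-\theta_0\}\to N$ in distribution. (c) If $\hat\lambda_G\to\lambda_0=0$ in probability and $\sqrt n\{\hat\theta(\hat\lambda_G)^T-\theta_0^T,\ \hat\theta(0)^T-\theta_0^T,\ \hat\lambda_G\}^T\to(N_1^T,N_2^T,N_3)^T\sim\mathrm{N}(0,V)$ in distribution for some matrix $V$, then $\hat\theta_T(\hat\lambda_G)\to\theta_0$ in probability and $\sqrt n\{\hat\theta_T(\hat\lambda_G)-\theta_0\}\to I(N_3\ge 0)N_1+I(N_3<0)N_2$ in distribution. (d) If $\hat\lambda_G\to\lambda_0=1$ in probability and $\sqrt n\{\hat\theta(\hat\lambda_G)^T-\theta_0^T,\ \hat\theta(1)^T-\theta_0^T,\ \hat\lambda_G-1\}^T\to(N_1^T,N_2^T,N_3)^T\sim\mathrm{N}(0,V)$ in distribution for some matrix $V$, then $\hat\theta_T(\hat\lambda_G)\to\theta_0$ in probability and $\sqrt n\{\hat\theta_T(\hat\lambda_G)-\theta_0\}\to I(N_3\le 0)N_1+I(N_3>0)N_2$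 in distribution.
   Context: $\varphi\colon\mathbb{R}^{d+p+1}\to\mathbb{R}^p$ is the estimating function and $\psi\colon\mathbb{R}^{d+p}\to\mathbb{R}$ the loss function; both are smooth enough in $(\theta,\lambda)$ that all derivatives appearing exist. $\nabla$ denotes gradient and $\partial$ the Jacobian; a prime denotes differentiation with respect to the argument. With $\alpha=(\theta^T,\lambda,D^T)^T\in\mathbb{R}^{p+1+p}$, the function $\eta(z,\alpha)=(\eta_1^T,\eta_2,\eta_3^T)^T$ is defined by $\eta_1=\varphi(z,\theta,\lambda)$, $\eta_2=D^T\nabla_\theta\psi(z,\theta)$, $\eta_3=\partial_\theta\varphi(z,\theta,\lambda)D+\partial_\lambda\varphi(z,\theta,\lambda)$. *)

theory Defs
  imports "HOL-Probability.Probability"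
begin

definition tendsto_in_prob ::
    "'w measure \<Rightarrow> (nat \<Rightarrow> 'w \<Rightarrow> 'a::metric_space) \<Rightarrow> 'a \<Rightarrow> bool" where
  "tendsto_in_prob M X c \<longleftrightarrow>
     (\<forall>n. X n \<in> borel_measurable M) \<and>
     (\<forall>\<epsilon>>0. (\<lambda>n. measure M {\<omega> \<in> space M. dist (X n \<omega>) c > \<epsilon>}) \<longlonglongrightarrow> 0)"

text \<open>Convergence in distribution of the random elements \<open>X n\<close> on \<open>M\<close> to the random element
  \<open>Y\<close>, which may live on another probability space \<open>Q\<close>. The library's \<open>weak_conv_m\<close> only covers
  measures on the real line.\<close>

definition tendsto_in_distr ::
    "'w measure \<Rightarrow> (nat \<Rightarrow> 'w \<Rightarrow> 'a::metric_space) \<Rightarrow> 'v measure \<Rightarrow> ('v \<Rightarrow> 'a) \<Rightarrow> bool" where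
  "tendsto_in_distr M X Q Y \<longleftrightarrow>
     (\<forall>n. X n \<in> borel_measurable M) \<and> Y \<in> borel_measurable Q \<and>
     (\<forall>f :: 'a \<Rightarrow> real. continuous_on UNIV f \<and> bounded (range f) \<longrightarrow>
        (\<lambda>n. \<integral>\<omega>. f (X n \<omega>) \<partial>M) \<longlonglongrightarrow> (\<integral>\<omega>. f (Y \<omega>) \<partial>Q))"

text \<open>\<open>X\<close> has law N(0, V): every linear combination \<open>t \<bullet> X\<close> has the univariate normal law with
  mean zero and variance \<open>v\<close>, the value at \<open>t\<close> of the quadratic form of \<open>V\<close>; that law is written
  as the law of \<open>sqrt v\<close> times a standard normal variable, so that \<open>V\<close> may be singular. The entries
  of \<open>V\<close> are indexed by the standard basis.\<close>

definition centred_normal ::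
    "'v measure \<Rightarrow> ('v \<Rightarrow> 'a::euclidean_space) \<Rightarrow> ('a \<Rightarrow> 'a \<Rightarrow> real) \<Rightarrow> bool" where
  "centred_normal Q X V \<longleftrightarrow>
     X \<in> borel_measurable Q \<and>
     (\<forall>i\<in>Basis. \<forall>j\<in>Basis. V i j = V j i) \<and>
     (\<forall>t. let v = (\<Sum>i\<in>Basis. \<Sum>j\<in>Basis. (t \<bullet> i) * V i j * (t \<bullet> j)) in
        v \<ge> 0 \<and>
        distr Q borel (\<lambda>\<omega>. t \<bullet> X \<omega>) = distr std_normal_distribution borel (\<lambda>y. sqrt v * y))"

definition grad :: "('a::real_inner \<Rightarrow> real) \<Rightarrow> 'a \<Rightarrow> 'a" where
  "grad f x = (THE D. GDERIV f x :> D)"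

text \<open>The parameter \<open>\<alpha> = (\<theta>, \<lambda>, D)\<close> and the value of \<open>\<eta>\<close> live in the Euclidean product space
  \<open>R^p \<times> R \<times> R^p\<close>.\<close>

definition eta ::
    "('z \<Rightarrow> real^'p \<Rightarrow> real \<Rightarrow> real^'p) \<Rightarrow> ('z \<Rightarrow> real^'p \<Rightarrow> real) \<Rightarrow>
     'z \<Rightarrow> (real^'p) \<times> real \<times> (real^'p) \<Rightarrow> (real^'p) \<times> real \<times> (real^'p)" where
  "eta \<phi> \<psi> z = (\<lambda>(\<theta>, l, D).
     (\<phi> z \<theta> l,
      D \<bullet> grad (\<psi> z) \<theta>,
      jacobian (\<lambda>\<theta>. \<phi> z \<theta> l) (at \<theta>) *v D + vector_derivative (\<lambda>l. \<phi> z \<theta> l) (at l)))"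

definition Psi ::
    "('z \<Rightarrow> real^'p \<Rightarrow> real \<Rightarrow> real^'p) \<Rightarrow> ('z \<Rightarrow> real^'p \<Rightarrow> real) \<Rightarrow> 'z measure \<Rightarrow>
     (real^'p) \<times> real \<times> (real^'p) \<Rightarrow> (real^'p) \<times> real \<times> (real^'p)" where
  "Psi \<phi> \<psi> F \<alpha> = (\<integral>z. eta \<phi> \<psi> z \<alpha> \<partial>F)"

text \<open>An estimator \<open>\<theta>h n \<omega> l\<close> is the value, for sample size \<open>n\<close> and outcome \<open>\<omega>\<close>, at tuning
  parameter \<open>l\<close>.\<close>

definition TE ::
    "('z \<Rightarrow> real^'p \<Rightarrow> real) \<Rightarrow> (nat \<Rightarrow> 'w \<Rightarrow> 'z) \<Rightarrow> (nat \<Rightarrow> 'w \<Rightarrow> real \<Rightarrow> real^'p) \<Rightarrow>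
     nat \<Rightarrow> 'w \<Rightarrow> real \<Rightarrow> real" where
  "TE \<psi> Z \<theta>h n \<omega> l = (1 / real n) * (\<Sum>i=1..n. \<psi> (Z i \<omega>) (\<theta>h n \<omega> l))"

definition truncated ::
    "(nat \<Rightarrow> 'w \<Rightarrow> real \<Rightarrow> real^'p) \<Rightarrow> nat \<Rightarrow> 'w \<Rightarrow> real \<Rightarrow> real^'p" where
  "truncated \<theta>h n \<omega> l =
     indicator {..0} l *\<^sub>R \<theta>h n \<omega> 0 + indicator {0<..<1} l *\<^sub>R \<theta>h n \<omega> l
     + indicator {1..} l *\<^sub>R \<theta>h n \<omega> 1"

text \<open>The random sequence \<open>L n\<close> solves \<open>TE'(l) = o_p(1 / sqrt n)\<close>.\<close>

definition TE_stationary ::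
    "'w measure \<Rightarrow> ('z \<Rightarrow> real^'p \<Rightarrow> real) \<Rightarrow> (nat \<Rightarrow> 'w \<Rightarrow> 'z) \<Rightarrow>
     (nat \<Rightarrow> 'w \<Rightarrow> real \<Rightarrow> real^'p) \<Rightarrow> (nat \<Rightarrow> 'w \<Rightarrow> real) \<Rightarrow> bool" where
  "TE_stationary M \<psi> Z \<theta>h L \<longleftrightarrow>
     (\<forall>n. L n \<in> borel_measurable M) \<and>
     tendsto_in_prob M (\<lambda>n \<omega>. sqrt (real n) * deriv (TE \<psi> Z \<theta>h n \<omega>) (L n \<omega>)) 0"

text \<open>Uniqueness of a solution of an equation that holds up to \<open>o_p(1 / sqrt n)\<close> is uniqueness up
  to asymptotic equivalence: exact uniqueness is impossible, since altering a solution for a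
  single \<open>n\<close> gives another one.\<close>

definition unique_TE_stationary ::
    "'w measure \<Rightarrow> ('z \<Rightarrow> real^'p \<Rightarrow> real) \<Rightarrow> (nat \<Rightarrow> 'w \<Rightarrow> 'z) \<Rightarrow>
     (nat \<Rightarrow> 'w \<Rightarrow> real \<Rightarrow> real^'p) \<Rightarrow> (nat \<Rightarrow> 'w \<Rightarrow> real) \<Rightarrow> bool" where
  "unique_TE_stationary M \<psi> Z \<theta>h L \<longleftrightarrow>
     TE_stationary M \<psi> Z \<theta>h L \<and>
     (\<forall>L'. TE_stationary M \<psi> Z \<theta>h L' \<longrightarrow> tendsto_in_prob M (\<lambda>n \<omega>. L' n \<omega> - L n \<omega>) 0)"

definition eta_dominated ::
    "('z \<Rightarrow> real^'p \<Rightarrow> real \<Rightarrow> real^'p) \<Rightarrow> ('z \<Rightarrow> real^'p \<Rightarrow> real) \<Rightarrow> 'z measure \<Rightarrow>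
     (real^'p) \<times> real \<times> (real^'p) \<Rightarrow> bool" where
  "eta_dominated \<phi> \<psi> F \<alpha>0 \<longleftrightarrow>
     (\<exists>U m0 m1. open U \<and> \<alpha>0 \<in> U \<and>
        m0 \<in> borel_measurable F \<and> integrable F (\<lambda>z. (m0 z)\<^sup>2) \<and>
        m1 \<in> borel_measurable F \<and> integrable F (\<lambda>z. (m1 z)\<^sup>2) \<and>
        (\<forall>z. \<forall>\<alpha>\<in>U.
           norm (eta \<phi> \<psi> z \<alpha>) \<le> m0 z \<and>
           eta \<phi> \<psi> z differentiable (at \<alpha>) \<and>
           (\<forall>b\<in>Basis. \<forall>c\<in>Basis. \<bar>frechet_derivative (eta \<phi> \<psi> z) (at \<alpha>) b \<bullet> c\<bar> \<le> m1 z)))"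

definition C1_nonsingular_at :: "('a::euclidean_space \<Rightarrow> 'a) \<Rightarrow> 'a \<Rightarrow> bool" where
  "C1_nonsingular_at f a \<longleftrightarrow>
     (\<exists>U f'. open U \<and> a \<in> U \<and>
        (\<forall>x\<in>U. (f has_derivative blinfun_apply (f' x)) (at x)) \<and>
        continuous_on U f' \<and> bij (blinfun_apply (f' a)))"

end

theory Submission
  imports Defs
begin

text \<open>Off an event of vanishing probability, the truncated estimator equals \<open>\<theta>h 0\<close>, \<open>\<theta>h 1\<close> or
  \<open>\<theta>h lh\<close>, which settles (a) and (b). At the boundary the choice is a switch in the sign of
  \<open>lh - l0\<close>, discontinuous where the limit \<open>N3\<close> vanishes; \<open>N3\<close> may be degenerate, so the continuous
  mapping theorem alone does not suffice. The regularity of \<open>eta\<close> and \<open>Psi\<close> closes the gap: \<open>E J\<close>,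
  the mean Jacobian of \<open>\<phi>\<close> in \<open>\<theta>\<close>, is invertible because \<open>Psi'\<close> is, and a Newton contraction
  with the weak law of large numbers shows that, with probability tending to one,
  \<open>norm (\<theta>h lh - \<theta>h l0) \<le> K * \<bar>lh - l0\<bar>\<close>. On this cone the switch agrees with a continuous map,
  and the limit satisfies \<open>norm (N1 - N2) \<le> K * \<bar>N3\<bar>\<close> almost surely.\<close>

section \<open>Convergence in distribution and in probability\<close>

text \<open>The obstacle is that joint convergence alone does not relate \<open>N1\<close> to
  \<open>N2\<close> on \<open>N3 = 0\<close>, while the sign of \<open>lh - l0\<close> may keep
  changing when \<open>N3\<close> is degenerate. A linear rate in the parameter repairs this. Both
  sides of the cone inequality scale by \<open>sqrt n\<close>, the centring vector cancels from the
  difference of the two estimators, and the inequality is a closed condition, so it survives the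
  limit and forces \<open>N1 = N2\<close> almost surely on \<open>N3 = 0\<close>. Since
  \<open>lh\<close> is random, the rate has to hold uniformly for \<open>l\<close> near
  \<open>l0\<close>; this is why a contraction on one fixed ball is used rather than an expansion at
  \<open>l0\<close>. The ball is centred at the \<theta>-component of \<alpha>0. That the sample
  roots lie in it is not known in advance: the contraction produces a root there, and global
  uniqueness of the root identifies it with the estimator.\<close>

lemma norm_integral_le:
  fixes f :: "'a \<Rightarrow> 'b::{banach, second_countable_topology}"
  assumes "integrable M f" "integrable M g" "\<And>x. x \<in> space M \<Longrightarrow> norm (f x) \<le> g x"
  shows "norm (integral\<^sup>L M f) \<le> integral\<^sup>L M g"
proof -
  have "(\<integral>x. norm (f x) \<partial>M) \<le> integral\<^sup>L M g"
    using assms by (intro integral_mono) auto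
  then show ?thesis using integral_norm_bound[of M f] by linarith
qed

text \<open>A test function bounded by \<open>B\<close> changes by at most \<open>2 * B\<close>, and
  only on \<open>A n\<close>, so the two integrals differ by at most
  \<open>2 * B * prob (A n)\<close>.\<close>

lemma (in prob_space) tendsto_in_distr_cong_asymp:
  fixes X X' :: "nat \<Rightarrow> 'a \<Rightarrow> 'b::metric_space"
  assumes conv: "tendsto_in_distr M X Q Y"
    and X' [measurable]: "\<And>n. X' n \<in> borel_measurable M"
    and A [measurable]: "\<And>n. A n \<in> events"
    and A0: "(\<lambda>n. prob (A n)) \<longlonglongrightarrow> 0"
    and eq: "\<forall>\<^sub>F n in sequentially. \<forall>\<omega>\<in>space M - A n. X' n \<omega> = X n \<omega>"
  shows "tendsto_in_distr M X' Q Y"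
  unfolding tendsto_in_distr_def
proof (intro conjI allI impI)
  fix f :: "'b \<Rightarrow> real" assume f: "continuous_on UNIV f \<and> bounded (range f)"
  then obtain B where B: "\<And>x. \<bar>f x\<bar> \<le> B"
    by (auto simp: bounded_iff)
  have [measurable]: "f \<in> borel_measurable borel"
    using f by (auto intro: borel_measurable_continuous_onI)
  have [measurable]: "X n \<in> borel_measurable M" for n
    using conv by (auto simp: tendsto_in_distr_def)
  have int: "integrable M (\<lambda>\<omega>. f (X n \<omega>))" "integrable M (\<lambda>\<omega>. f (X' n \<omega>))" for n
    by (rule integrable_const_bound[where B=B]; use B in simp)+
  have "\<forall>\<^sub>F n in sequentially.
      norm ((\<integral>\<omega>. f (X' n \<omega>) \<partial>M) - (\<integral>\<omega>. f (X n \<omega>) \<partial>M)) \<le> 2 * B * prob (A n)"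
    using eq
  proof eventually_elim
    case (elim n)
    have "norm ((\<integral>\<omega>. f (X' n \<omega>) \<partial>M) - (\<integral>\<omega>. f (X n \<omega>) \<partial>M)) =
        norm (\<integral>\<omega>. f (X' n \<omega>) - f (X n \<omega>) \<partial>M)"
      using int by simp
    also have "\<dots> \<le> (\<integral>\<omega>. 2 * B * indicator (A n) \<omega> \<partial>M)"
    proof (rule norm_integral_le)
      fix \<omega> assume w: "\<omega> \<in> space M"
      show "norm (f (X' n \<omega>) - f (X n \<omega>)) \<le> 2 * B * indicator (A n) \<omega>"
        using elim w B[of "X' n \<omega>"] B[of "X n \<omega>"] by (cases "\<omega> \<in> A n") auto
    qed (use int in \<open>auto intro!: integrable_mult_right integrable_real_indicator simp: emeasure_eq_measure\<close>)
    also have "\<dots> = 2 * B * prob (A n)"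
      by simp
    finally show ?case .
  qed
  moreover have "(\<lambda>n. 2 * B * prob (A n)) \<longlonglongrightarrow> 0"
    using tendsto_mult_right_zero[OF A0] by simp
  ultimately have "(\<lambda>n. (\<integral>\<omega>. f (X' n \<omega>) \<partial>M) - (\<integral>\<omega>. f (X n \<omega>) \<partial>M)) \<longlonglongrightarrow> 0"
    by (rule Lim_null_comparison)
  moreover have "(\<lambda>n. \<integral>\<omega>. f (X n \<omega>) \<partial>M) \<longlonglongrightarrow> (\<integral>\<omega>. f (Y \<omega>) \<partial>Q)"
    using conv f by (auto simp: tendsto_in_distr_def)
  ultimately show "(\<lambda>n. \<integral>\<omega>. f (X' n \<omega>) \<partial>M) \<longlonglongrightarrow> (\<integral>\<omega>. f (Y \<omega>) \<partial>Q)"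
    by (auto dest: tendsto_add)
qed (use conv in \<open>auto simp: tendsto_in_distr_def\<close>)

lemma tendsto_in_distr_cong_limit:
  assumes "tendsto_in_distr M X Q Y" "Y' \<in> borel_measurable Q" "AE \<omega> in Q. Y \<omega> = Y' \<omega>"
  shows "tendsto_in_distr M X Q Y'"
proof -
  have "(\<integral>\<omega>. f (Y \<omega>) \<partial>Q) = (\<integral>\<omega>. f (Y' \<omega>) \<partial>Q)"
    if "continuous_on UNIV f" for f :: "_ \<Rightarrow> real"
  proof -
    have [measurable]: "f \<in> borel_measurable borel"
      using that by (rule borel_measurable_continuous_onI)
    show ?thesis
      using assms by (intro integral_cong_AE) (auto simp: tendsto_in_distr_def)
  qed
  then show ?thesis
    using assms by (auto simp: tendsto_in_distr_def)
qed

lemma tendsto_in_distr_continuous: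
  fixes g :: "'b::metric_space \<Rightarrow> 'c::metric_space"
  assumes conv: "tendsto_in_distr M X Q Y" and g: "continuous_on UNIV g"
  shows "tendsto_in_distr M (\<lambda>n \<omega>. g (X n \<omega>)) Q (\<lambda>\<omega>. g (Y \<omega>))"
  unfolding tendsto_in_distr_def
proof (intro conjI allI impI)
  have [measurable]: "g \<in> borel_measurable borel"
    using g by (rule borel_measurable_continuous_onI)
  have [measurable]: "X n \<in> borel_measurable M" "Y \<in> borel_measurable Q" for n
    using conv by (auto simp: tendsto_in_distr_def)
  show "(\<lambda>\<omega>. g (X n \<omega>)) \<in> borel_measurable M" for n
    by measurable
  show "(\<lambda>\<omega>. g (Y \<omega>)) \<in> borel_measurable Q"
    by measurable
next
  fix f :: "'c \<Rightarrow> real" assume f: "continuous_on UNIV f \<and> bounded (range f)"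
  have "continuous_on UNIV (\<lambda>x. f (g x))"
    by (rule continuous_on_compose2[of UNIV f UNIV g]) (use f g in auto)
  moreover have "bounded (range (\<lambda>x. f (g x)))"
    using f by (auto intro: bounded_subset)
  ultimately show "(\<lambda>n. \<integral>\<omega>. f (g (X n \<omega>)) \<partial>M) \<longlonglongrightarrow> (\<integral>\<omega>. f (g (Y \<omega>)) \<partial>Q)"
    using conv unfolding tendsto_in_distr_def by blast
qed

text \<open>The test function \<open>min 1 (max 0 (h x))\<close> vanishes exactly where
  \<open>h x \<le> 0\<close> and lies below the indicator of \<open>h x > 0\<close>. Its integrals
  tend to zero, so its integral in the limit is zero, and a nonnegative function with zero integral
  vanishes almost everywhere.\<close>

lemma tendsto_in_distr_AE_nonpos:
  fixes X :: "nat \<Rightarrow> 'a \<Rightarrow> 'b::metric_space" and h :: "'b \<Rightarrow> real"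
  assumes "prob_space M" "prob_space Q"
    and conv: "tendsto_in_distr M X Q Y" and h: "continuous_on UNIV h"
    and lim: "(\<lambda>n. measure M {\<omega> \<in> space M. h (X n \<omega>) > 0}) \<longlonglongrightarrow> 0"
  shows "AE \<omega> in Q. h (Y \<omega>) \<le> 0"
proof -
  interpret M: prob_space M by fact
  interpret Q: prob_space Q by fact
  have [measurable]: "X n \<in> borel_measurable M" "Y \<in> borel_measurable Q" for n
    using conv by (auto simp: tendsto_in_distr_def)
  define f where "f x = min 1 (max 0 (h x))" for x
  have f: "continuous_on UNIV f" unfolding f_def by (intro continuous_intros h)
  have bd: "bounded (range f)" by (rule boundedI[where B=1]) (auto simp: f_def)
  have [measurable]: "h \<in> borel_measurable borel" "f \<in> borel_measurable borel"
    using f h by (auto intro: borel_measurable_continuous_onI)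
  have "(\<lambda>n. \<integral>\<omega>. f (X n \<omega>) \<partial>M) \<longlonglongrightarrow> 0"
  proof (rule Lim_null_comparison[OF always_eventually lim], rule allI)
    fix n
    have "norm (\<integral>\<omega>. f (X n \<omega>) \<partial>M) \<le> (\<integral>\<omega>. indicator {\<omega> \<in> space M. h (X n \<omega>) > 0} \<omega> \<partial>M)"
    proof (rule norm_integral_le)
      show "integrable M (\<lambda>\<omega>. f (X n \<omega>))"
        by (rule M.integrable_const_bound[where B=1]) (auto simp: f_def)
    qed (auto simp: f_def M.emeasure_eq_measure intro!: integrable_real_indicator split: split_indicator)
    also have "\<dots> = measure M {\<omega> \<in> space M. h (X n \<omega>) > 0}"
      by (auto simp: Int_def conj_commute)
    finally show "norm (\<integral>\<omega>. f (X n \<omega>) \<partial>M) \<le> measure M {\<omega> \<in> space M. h (X n \<omega>) > 0}" .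
  qed
  moreover have "(\<lambda>n. \<integral>\<omega>. f (X n \<omega>) \<partial>M) \<longlonglongrightarrow> (\<integral>\<omega>. f (Y \<omega>) \<partial>Q)"
    using conv f bd by (auto simp: tendsto_in_distr_def)
  ultimately have "(\<integral>\<omega>. f (Y \<omega>) \<partial>Q) = 0"
    using LIMSEQ_unique by blast
  moreover have "integrable Q (\<lambda>\<omega>. f (Y \<omega>))"
    by (rule Q.integrable_const_bound[where B=1]) (auto simp: f_def)
  ultimately have "AE \<omega> in Q. f (Y \<omega>) = 0"
    by (subst (asm) integral_nonneg_eq_0_iff_AE) (auto simp: f_def)
  then show ?thesis
    by eventually_elim (auto simp: f_def min_def max_def split: if_splits)
qed

text \<open>A weakly convergent sequence is tight, so division by \<open>sqrt n\<close> sends it to zero.\<close>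

lemma tendsto_in_prob_of_root_n:
  fixes Y :: "nat \<Rightarrow> 'w \<Rightarrow> 'b::euclidean_space"
  assumes "prob_space M" "prob_space Q"
    and Y [measurable]: "\<And>n. Y n \<in> borel_measurable M"
    and conv: "tendsto_in_distr M (\<lambda>n \<omega>. sqrt (real n) *\<^sub>R (Y n \<omega> - c)) Q N"
  shows "tendsto_in_prob M Y c"
  unfolding tendsto_in_prob_def
proof (intro conjI allI impI)
  interpret M: prob_space M by fact
  interpret Q: prob_space Q by fact
  have [measurable]: "N \<in> borel_measurable Q"
    using conv by (auto simp: tendsto_in_distr_def)
  fix \<epsilon> :: real assume e: "\<epsilon> > 0"
  \<comment> \<open>A continuous cutoff: zero up to norm \<open>k\<close> and one from norm
    \<open>k + 1\<close> on. First \<open>k\<close> is chosen so that the limit has integral below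
    \<open>r\<close>; then \<open>n\<close> is taken so large that an error above \<epsilon> makes
    the scaled error at least \<open>k + 1\<close>, where the cutoff equals one.\<close>
  define f where "f k x = min 1 (max 0 (norm x - real k))" for k and x :: 'b
  have f: "continuous_on UNIV (f k)" for k unfolding f_def by (intro continuous_intros)
  have bd: "bounded (range (f k))" for k by (rule boundedI[where B=1]) (auto simp: f_def)
  have [measurable]: "f k \<in> borel_measurable borel" for k
    using f by (auto intro: borel_measurable_continuous_onI)
  have "(\<lambda>k. \<integral>\<omega>. f k (N \<omega>) \<partial>Q) \<longlonglongrightarrow> (\<integral>\<omega>. 0 \<partial>Q)"
  proof (rule integral_dominated_convergence[where w="\<lambda>_. 1"])
    show "AE x in Q. (\<lambda>k. f k (N x)) \<longlonglongrightarrow> 0"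
    proof (rule AE_I2)
      fix x
      obtain m where "norm (N x) \<le> real m" using real_arch_simple by blast
      then have "\<forall>\<^sub>F k in sequentially. f k (N x) = 0"
        by (auto simp: eventually_sequentially f_def intro!: exI[of _ m])
      then show "(\<lambda>k. f k (N x)) \<longlonglongrightarrow> 0" by (rule tendsto_eventually)
    qed
  qed (auto simp: f_def)
  then have fk: "(\<lambda>k. \<integral>\<omega>. f k (N \<omega>) \<partial>Q) \<longlonglongrightarrow> 0" by simp
  show "(\<lambda>n. measure M {\<omega> \<in> space M. dist (Y n \<omega>) c > \<epsilon>}) \<longlonglongrightarrow> 0"
  proof (rule tendstoI)
    fix r :: real assume "r > 0"
    with fk have "\<forall>\<^sub>F k in sequentially. \<bar>\<integral>\<omega>. f k (N \<omega>) \<partial>Q\<bar> < r"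
      by (auto dest!: tendstoD[where e=r])
    then obtain k where k: "\<bar>\<integral>\<omega>. f k (N \<omega>) \<partial>Q\<bar> < r"
      using eventually_happens by fastforce
    have "(\<lambda>n. \<integral>\<omega>. f k (sqrt (real n) *\<^sub>R (Y n \<omega> - c)) \<partial>M) \<longlonglongrightarrow> (\<integral>\<omega>. f k (N \<omega>) \<partial>Q)"
      using conv f[of k] bd[of k] by (auto simp: tendsto_in_distr_def)
    then have "\<forall>\<^sub>F n in sequentially. (\<integral>\<omega>. f k (sqrt (real n) *\<^sub>R (Y n \<omega> - c)) \<partial>M) < r"
      by (rule order_tendstoD) (use k in auto)
    moreover have "filterlim (\<lambda>n. sqrt (real n) * \<epsilon>) at_top sequentially"
      by (intro filterlim_at_top_mult_tendsto_pos[where c=\<epsilon>, OF tendsto_const e]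
            filterlim_compose[OF sqrt_at_top filterlim_real_sequentially])
    then have "\<forall>\<^sub>F n in sequentially. sqrt (real n) * \<epsilon> \<ge> real k + 1"
      by (simp add: filterlim_at_top)
    ultimately show "\<forall>\<^sub>F n in sequentially.
        dist (measure M {\<omega> \<in> space M. dist (Y n \<omega>) c > \<epsilon>}) 0 < r"
    proof eventually_elim
      case (elim n)
      have "measure M {\<omega> \<in> space M. dist (Y n \<omega>) c > \<epsilon>} =
          (\<integral>\<omega>. indicator {\<omega> \<in> space M. dist (Y n \<omega>) c > \<epsilon>} \<omega> \<partial>M)"
        by (auto simp: Int_def conj_commute)
      also have "\<dots> \<le> (\<integral>\<omega>. f k (sqrt (real n) *\<^sub>R (Y n \<omega> - c)) \<partial>M)"
      proof (rule integral_mono)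
        show "integrable M (\<lambda>\<omega>. f k (sqrt (real n) *\<^sub>R (Y n \<omega> - c)))"
          by (rule M.integrable_const_bound[where B=1]) (auto simp: f_def)
        fix \<omega> assume "\<omega> \<in> space M"
        show "indicator {\<omega> \<in> space M. dist (Y n \<omega>) c > \<epsilon>} \<omega>
            \<le> f k (sqrt (real n) *\<^sub>R (Y n \<omega> - c))"
        proof (cases "dist (Y n \<omega>) c > \<epsilon>")
          case True
          then have "sqrt (real n) * \<epsilon> \<le> sqrt (real n) * norm (Y n \<omega> - c)"
            by (intro mult_left_mono) (auto simp: dist_norm)
          with elim have "norm (sqrt (real n) *\<^sub>R (Y n \<omega> - c)) \<ge> real k + 1" by simp
          then show ?thesis by (auto simp: f_def split: split_indicator)
        qed (auto simp: f_def)
      qed (auto intro!: integrable_real_indicator simp: M.emeasure_eq_measure)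
      also have "\<dots> < r" by (rule elim)
      finally show ?case by simp
    qed
  qed
qed (use Y in auto)

text \<open>The discontinuous switch at \<open>C = 0\<close> agrees, on the cone \<open>norm (A - B) \<le> K * \<bar>C\<bar>\<close>, with a
  continuous map, and the limit is concentrated on that cone too. Hence no continuity of the law
  of \<open>N3\<close> at zero is needed, and a degenerate \<open>N3\<close> is allowed.\<close>

lemma tendsto_in_distr_switch:
  fixes A B :: "nat \<Rightarrow> 'w \<Rightarrow> 'b::euclidean_space" and C :: "nat \<Rightarrow> 'w \<Rightarrow> real"
  assumes M: "prob_space M" and Q: "prob_space Q"
    and conv: "tendsto_in_distr M (\<lambda>n \<omega>. (A n \<omega>, B n \<omega>, C n \<omega>)) Q (\<lambda>\<omega>. (N1 \<omega>, N2 \<omega>, N3 \<omega>))"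
    and cone: "(\<lambda>n. measure M {\<omega> \<in> space M. norm (A n \<omega> - B n \<omega>) > K * \<bar>C n \<omega>\<bar>}) \<longlonglongrightarrow> 0"
    and T [measurable]: "\<And>n. T n \<in> borel_measurable M"
    and S [measurable]: "\<And>n. S n \<in> sets M"
    and S0: "(\<lambda>n. measure M (S n)) \<longlonglongrightarrow> 0"
    and switch: "\<forall>\<^sub>F n in sequentially. \<forall>\<omega>\<in>space M - S n.
      T n \<omega> = (if C n \<omega> > 0 then A n \<omega> else B n \<omega>)"
  shows "tendsto_in_distr M T Q
    (\<lambda>\<omega>. indicator {0..} (N3 \<omega>) *\<^sub>R N1 \<omega> + indicator {..<0} (N3 \<omega>) *\<^sub>R N2 \<omega>)"
proof -
  interpret prob_space M by fact
  \<comment> \<open>Each coordinate of \<open>a - b\<close> is clipped to the interval of half-width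
    \<open>K * max c 0\<close>. For \<open>c > 0\<close> the clipping is inactive on the cone and
    gives \<open>a\<close>; for \<open>c \<le> 0\<close> the interval shrinks to zero and gives
    \<open>b\<close>.\<close>
  define G :: "'b \<times> 'b \<times> real \<Rightarrow> 'b" where
    "G = (\<lambda>(a, b, c). b + (\<Sum>i\<in>Basis.
       max (- (K * max c 0)) (min (K * max c 0) ((a - b) \<bullet> i)) *\<^sub>R i))"
  have G: "continuous_on UNIV G"
    unfolding G_def case_prod_unfold by (intro continuous_intros)
  have G_eq: "G (a, b, c) = (if c > 0 then a else b)" if "norm (a - b) \<le> K * \<bar>c\<bar>" for a b c
  proof (cases "c > 0")
    case True
    have "max (- (K * c)) (min (K * c) ((a - b) \<bullet> i)) = (a - b) \<bullet> i" if "i \<in> Basis" for i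
      using Basis_le_norm[OF that, of "a - b"] \<open>norm (a - b) \<le> K * \<bar>c\<bar>\<close> True by auto
    then show ?thesis
      using True by (simp add: G_def euclidean_representation)
  qed (simp add: G_def)
  have pr: "continuous_on UNIV (fst :: 'b \<times> 'b \<times> real \<Rightarrow> 'b)"
    "continuous_on UNIV (\<lambda>x :: 'b \<times> 'b \<times> real. fst (snd x))"
    "continuous_on UNIV (\<lambda>x :: 'b \<times> 'b \<times> real. snd (snd x))"
    by (intro continuous_intros)+
  have "(\<lambda>\<omega>. (A n \<omega>, B n \<omega>, C n \<omega>)) \<in> borel_measurable M" for n
    using conv by (auto simp: tendsto_in_distr_def)
  from pr[THEN borel_measurable_continuous_on, OF this]
  have [measurable]: "A n \<in> borel_measurable M" "B n \<in> borel_measurable M"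
    "C n \<in> borel_measurable M" for n
    by simp_all
  have "(\<lambda>\<omega>. (N1 \<omega>, N2 \<omega>, N3 \<omega>)) \<in> borel_measurable Q"
    using conv by (auto simp: tendsto_in_distr_def)
  from pr[THEN borel_measurable_continuous_on, OF this]
  have [measurable]: "N1 \<in> borel_measurable Q" "N2 \<in> borel_measurable Q"
    "N3 \<in> borel_measurable Q"
    by simp_all
  define E where "E n = {\<omega> \<in> space M. norm (A n \<omega> - B n \<omega>) > K * \<bar>C n \<omega>\<bar>} \<union> S n" for n
  have [measurable]: "E n \<in> sets M" for n unfolding E_def by measurable
  have "(\<lambda>n. measure M (E n)) \<longlonglongrightarrow> 0"
  proof (rule Lim_null_comparison[OF always_eventually])
    show "\<forall>n. norm (measure M (E n)) \<le>
        measure M {\<omega> \<in> space M. norm (A n \<omega> - B n \<omega>) > K * \<bar>C n \<omega>\<bar>} + measure M (S n)"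
      unfolding E_def by (auto intro!: measure_subadditive simp: emeasure_eq_measure)
    show "(\<lambda>n. measure M {\<omega> \<in> space M. norm (A n \<omega> - B n \<omega>) > K * \<bar>C n \<omega>\<bar>}
        + measure M (S n)) \<longlonglongrightarrow> 0"
      using tendsto_add[OF cone S0] by simp
  qed
  moreover have "\<forall>\<^sub>F n in sequentially. \<forall>\<omega>\<in>space M - E n. T n \<omega> = G (A n \<omega>, B n \<omega>, C n \<omega>)"
    using switch
  proof eventually_elim
    case (elim n)
    show ?case
    proof
      fix \<omega> assume w: "\<omega> \<in> space M - E n"
      then have "norm (A n \<omega> - B n \<omega>) \<le> K * \<bar>C n \<omega>\<bar>" by (auto simp: E_def)
      with elim w show "T n \<omega> = G (A n \<omega>, B n \<omega>, C n \<omega>)" by (simp add: G_eq E_def)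
    qed
  qed
  ultimately have lim: "tendsto_in_distr M T Q (\<lambda>\<omega>. G (N1 \<omega>, N2 \<omega>, N3 \<omega>))"
    by (intro tendsto_in_distr_cong_asymp[OF tendsto_in_distr_continuous[OF conv G]]) auto
  \<comment> \<open>The cone is the set where a continuous function is nonpositive, so the limit
    inherits it.\<close>
  have "AE \<omega> in Q. (\<lambda>(a, b, c). norm (a - b) - K * \<bar>c\<bar>) (N1 \<omega>, N2 \<omega>, N3 \<omega>) \<le> 0"
    by (rule tendsto_in_distr_AE_nonpos[OF M Q conv])
      (use cone in \<open>auto simp: case_prod_unfold intro!: continuous_intros\<close>)
  then have lim_eq: "AE \<omega> in Q. G (N1 \<omega>, N2 \<omega>, N3 \<omega>) =
      indicator {0..} (N3 \<omega>) *\<^sub>R N1 \<omega> + indicator {..<0} (N3 \<omega>) *\<^sub>R N2 \<omega>"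
  proof eventually_elim
    case (elim \<omega>)
    then show ?case
      \<comment> \<open>At \<open>N3 = 0\<close> the map \<open>G\<close> returns \<open>N2\<close>
        while the indicators select \<open>N1\<close>; the cone makes the two equal.\<close>
      by (cases "N3 \<omega> = 0") (auto simp: G_eq split: split_indicator)
  qed
  show ?thesis
    by (rule tendsto_in_distr_cong_limit[OF lim _ lim_eq]) measurable
qed

lemma tendsto_in_prob_outside:
  assumes "prob_space M" and X: "tendsto_in_prob M X c" and S: "open S" "c \<in> S"
  shows "(\<lambda>n. measure M {\<omega> \<in> space M. X n \<omega> \<notin> S}) \<longlonglongrightarrow> 0"
proof -
  interpret prob_space M by fact
  have [measurable]: "X n \<in> borel_measurable M" for n using X by (auto simp: tendsto_in_prob_def)
  obtain e where e: "e > 0" "ball c e \<subseteq> S" using S by (auto simp: open_contains_ball)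
  \<comment> \<open>Outside \<open>S\<close> the distance to \<open>c\<close> is at least
    \<open>e\<close>, whereas the definition speaks of strict excess; halving \<open>e\<close>
    bridges the gap.\<close>
  have lim: "(\<lambda>n. prob {\<omega> \<in> space M. dist (X n \<omega>) c > e / 2}) \<longlonglongrightarrow> 0"
    using X half_gt_zero[OF e(1)] unfolding tendsto_in_prob_def by blast
  have "prob {\<omega> \<in> space M. X n \<omega> \<notin> S} \<le> prob {\<omega> \<in> space M. dist (X n \<omega>) c > e / 2}" for n
  proof (rule finite_measure_mono)
    show "{\<omega> \<in> space M. X n \<omega> \<notin> S} \<subseteq> {\<omega> \<in> space M. dist (X n \<omega>) c > e / 2}"
      using e by (force simp: subset_eq dist_commute)
    have "(\<lambda>\<omega>. dist (X n \<omega>) c) \<in> borel_measurable M"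
      by (rule borel_measurable_continuous_on[where f="\<lambda>x. dist x c"]) (auto intro!: continuous_intros)
    then show "{\<omega> \<in> space M. dist (X n \<omega>) c > e / 2} \<in> events" by measurable
  qed
  then show ?thesis by (intro Lim_null_comparison[OF always_eventually lim]) auto
qed

section \<open>The weak law of large numbers\<close>

text \<open>On expanding the square, independence factorises each mixed expectation and the zero
  means annihilate it, so only the diagonal remains.\<close>

lemma (in prob_space) second_moment_sum_indep:
  fixes Y :: "nat \<Rightarrow> 'a \<Rightarrow> real"
  assumes ind: "indep_vars (\<lambda>_. borel) Y I" and "finite I"
    and sq: "\<And>i. i \<in> I \<Longrightarrow> integrable M (\<lambda>\<omega>. (Y i \<omega>)\<^sup>2)"
    and zero: "\<And>i. i \<in> I \<Longrightarrow> expectation (Y i) = 0"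
  shows "integrable M (\<lambda>\<omega>. (\<Sum>i\<in>I. Y i \<omega>)\<^sup>2)"
    and "expectation (\<lambda>\<omega>. (\<Sum>i\<in>I. Y i \<omega>)\<^sup>2) = (\<Sum>i\<in>I. expectation (\<lambda>\<omega>. (Y i \<omega>)\<^sup>2))"
proof -
  have meas: "Y i \<in> borel_measurable M" if "i \<in> I" for i
    using ind that by (auto simp: indep_vars_def)
  have int: "integrable M (Y i)" if "i \<in> I" for i
    using square_integrable_imp_integrable[OF meas[OF that] sq[OF that]] .
  have cross: "integrable M (\<lambda>\<omega>. Y i \<omega> * Y j \<omega>) \<and>
      expectation (\<lambda>\<omega>. Y i \<omega> * Y j \<omega>) = (if i = j then expectation (\<lambda>\<omega>. (Y i \<omega>)\<^sup>2) else 0)"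
    if "i \<in> I" "j \<in> I" for i j
  proof (cases "i = j")
    case True
    then show ?thesis using sq[OF that(1)] by (simp add: power2_eq_square)
  next
    case False
    have ind2: "indep_vars (\<lambda>_. borel) Y {i, j}"
      using that by (intro indep_vars_subset[OF ind]) auto
    have "integrable M (\<lambda>\<omega>. \<Prod>k\<in>{i, j}. Y k \<omega>)"
      using that int by (intro indep_vars_integrable[OF _ ind2]) auto
    moreover have "expectation (\<lambda>\<omega>. \<Prod>k\<in>{i, j}. Y k \<omega>) = (\<Prod>k\<in>{i, j}. expectation (Y k))"
      using that int by (intro indep_vars_lebesgue_integral[OF _ ind2]) auto
    ultimately show ?thesis using False zero that by simp
  qed
  have eq: "(\<Sum>i\<in>I. Y i \<omega>)\<^sup>2 = (\<Sum>i\<in>I. \<Sum>j\<in>I. Y i \<omega> * Y j \<omega>)" for \<omega>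
    by (simp add: power2_eq_square sum_product)
  show "integrable M (\<lambda>\<omega>. (\<Sum>i\<in>I. Y i \<omega>)\<^sup>2)"
    unfolding eq using cross by (intro Bochner_Integration.integrable_sum) auto
  have "expectation (\<lambda>\<omega>. (\<Sum>i\<in>I. Y i \<omega>)\<^sup>2) = (\<Sum>i\<in>I. \<Sum>j\<in>I. expectation (\<lambda>\<omega>. Y i \<omega> * Y j \<omega>))"
    unfolding eq using cross by (simp add: Bochner_Integration.integral_sum)
  also have "\<dots> = (\<Sum>i\<in>I. \<Sum>j\<in>I. if i = j then expectation (\<lambda>\<omega>. (Y i \<omega>)\<^sup>2) else 0)"
    using cross by (intro sum.cong refl) auto
  finally show "expectation (\<lambda>\<omega>. (\<Sum>i\<in>I. Y i \<omega>)\<^sup>2) = (\<Sum>i\<in>I. expectation (\<lambda>\<omega>. (Y i \<omega>)\<^sup>2))"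
    using \<open>finite I\<close> by simp
qed

text \<open>Chebyshev's inequality: the centred sum has second moment \<open>n * v\<close>, so
  Markov's inequality for its square bounds the deviation probability by
  \<open>v / \<epsilon>\<^sup>2 / n\<close>.\<close>

lemma (in prob_space) weak_law_real:
  fixes Z :: "nat \<Rightarrow> 'a \<Rightarrow> 'z::topological_space" and f :: "'z \<Rightarrow> real"
  assumes ind: "indep_vars (\<lambda>_. borel) Z {1..}"
    and distr: "\<And>i. i \<ge> 1 \<Longrightarrow> distr M borel (Z i) = F"
    and f [measurable]: "f \<in> borel_measurable borel"
    and sq: "integrable F (\<lambda>z. (f z)\<^sup>2)" and "\<epsilon> > 0"
  shows "(\<lambda>n. prob {\<omega> \<in> space M.
      \<bar>(1 / real n) * (\<Sum>i=1..n. f (Z i \<omega>)) - (\<integral>z. f z \<partial>F)\<bar> > \<epsilon>}) \<longlonglongrightarrow> 0"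
proof -
  have Z [measurable]: "Z i \<in> borel_measurable M" if "i \<ge> 1" for i
    using ind that by (auto simp: indep_vars_def)
  have "prob_space F" using prob_space_distr[OF Z[of 1]] distr[of 1] by simp
  then interpret F: prob_space F .
  have [measurable_cong]: "sets F = sets borel" using distr[of 1] by (metis order_refl sets_distr)
  define \<mu> where "\<mu> = (\<integral>z. f z \<partial>F)"
  define g where "g z = f z - \<mu>" for z
  have [measurable]: "g \<in> borel_measurable borel" unfolding g_def by measurable
  have intf: "integrable F f" by (rule F.square_integrable_imp_integrable[OF _ sq]) measurable
  have sqg: "integrable F (\<lambda>z. (g z)\<^sup>2)"
    unfolding g_def power2_diff using sq intf
    by (intro Bochner_Integration.integrable_add Bochner_Integration.integrable_diff) (auto simp: mult.assoc)
  have g0: "(\<integral>z. g z \<partial>F) = 0" unfolding g_def using intf by (simp add: \<mu>_def F.prob_space)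
  define v where "v = (\<integral>z. (g z)\<^sup>2 \<partial>F)"
  \<comment> \<open>Change of variables between the sample space and the common law
    \<open>F\<close>.\<close>
  have move: "integrable M (\<lambda>\<omega>. k (Z i \<omega>)) = integrable F k"
      "expectation (\<lambda>\<omega>. k (Z i \<omega>)) = (\<integral>z. k z \<partial>F)"
    if "i \<ge> 1" "k \<in> borel_measurable borel" for i and k :: "'z \<Rightarrow> real"
    using integrable_distr_eq[OF Z[OF that(1)], of k] integral_distr[OF Z[OF that(1)], of k]
      distr[OF that(1)] that(2) by auto
  have indg: "indep_vars (\<lambda>_. borel) (\<lambda>i \<omega>. g (Z i \<omega>)) {1..n}" for n
    by (rule indep_vars_compose2[OF indep_vars_subset[OF ind]]) auto
  have gM: "integrable M (\<lambda>\<omega>. (g (Z i \<omega>))\<^sup>2)" "expectation (\<lambda>\<omega>. g (Z i \<omega>)) = 0"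
    "expectation (\<lambda>\<omega>. (g (Z i \<omega>))\<^sup>2) = v" if "Suc 0 \<le> i" for i
    using that move[of i g] move[of i "\<lambda>z. (g z)\<^sup>2"] sqg g0 by (simp_all add: v_def)
  have bound: "prob {\<omega> \<in> space M. \<bar>(1 / real n) * (\<Sum>i=1..n. f (Z i \<omega>)) - \<mu>\<bar> > \<epsilon>} \<le> v / \<epsilon>\<^sup>2 / n"
    if "n \<ge> 1" for n
  proof -
    let ?S = "\<lambda>\<omega>. \<Sum>i=1..n. g (Z i \<omega>)"
    have S: "integrable M (\<lambda>\<omega>. (?S \<omega>)\<^sup>2)" "expectation (\<lambda>\<omega>. (?S \<omega>)\<^sup>2) = n * v"
      using second_moment_sum_indep[OF indg[of n]] gM by (auto simp: v_def)
    have "prob {\<omega> \<in> space M. \<bar>(1 / real n) * (\<Sum>i=1..n. f (Z i \<omega>)) - \<mu>\<bar> > \<epsilon>}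
        \<le> prob {\<omega> \<in> space M. (?S \<omega>)\<^sup>2 \<ge> (n * \<epsilon>)\<^sup>2}"
    proof (rule finite_measure_mono, safe)
      fix \<omega> assume *: "\<bar>(1 / real n) * (\<Sum>i=1..n. f (Z i \<omega>)) - \<mu>\<bar> > \<epsilon>"
      have "n * ((1 / real n) * (\<Sum>i=1..n. f (Z i \<omega>)) - \<mu>) = ?S \<omega>"
        using that by (simp add: g_def sum_subtractf right_diff_distrib)
      then have "\<bar>?S \<omega>\<bar> = n * \<bar>(1 / real n) * (\<Sum>i=1..n. f (Z i \<omega>)) - \<mu>\<bar>"
        using abs_mult[of "real n" "(1 / real n) * (\<Sum>i=1..n. f (Z i \<omega>)) - \<mu>"] by simp
      with * have "\<bar>?S \<omega>\<bar> \<ge> n * \<epsilon>" by (simp add: mult_left_mono)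
      then show "(?S \<omega>)\<^sup>2 \<ge> (n * \<epsilon>)\<^sup>2"
        using \<open>\<epsilon> > 0\<close> abs_le_square_iff[of "n * \<epsilon>" "?S \<omega>"] by (simp add: abs_mult)
    qed measurable
    also have "\<dots> \<le> expectation (\<lambda>\<omega>. (?S \<omega>)\<^sup>2) / (n * \<epsilon>)\<^sup>2"
      using that \<open>\<epsilon> > 0\<close> by (intro integral_Markov_inequality_measure[OF S(1), where A="{}"]) auto
    also have "\<dots> = v / \<epsilon>\<^sup>2 / n"
      unfolding S(2) using that by (simp add: power2_eq_square field_simps)
    finally show ?thesis .
  qed
  show ?thesis unfolding \<mu>_def[symmetric]
  proof (rule Lim_null_comparison)
    show "\<forall>\<^sub>F n in sequentially. norm (prob {\<omega> \<in> space M.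
        \<bar>(1 / real n) * (\<Sum>i=1..n. f (Z i \<omega>)) - \<mu>\<bar> > \<epsilon>}) \<le> v / \<epsilon>\<^sup>2 / n"
      using bound by (auto simp: eventually_sequentially intro!: exI[of _ 1])
    show "(\<lambda>n. v / \<epsilon>\<^sup>2 / real n) \<longlonglongrightarrow> 0" by (rule lim_const_over_n)
  qed
qed

text \<open>The scalar law applies to each coordinate with threshold
  \<open>\<epsilon> / DIM('b)\<close>: if no coordinate exceeds it, the sum of the absolute
  coordinates, and hence the norm, is at most \<epsilon>.\<close>

lemma (in prob_space) weak_law:
  fixes Z :: "nat \<Rightarrow> 'a \<Rightarrow> 'z::topological_space" and f :: "'z \<Rightarrow> 'b::euclidean_space"
  assumes ind: "indep_vars (\<lambda>_. borel) Z {1..}"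
    and distr: "\<And>i. i \<ge> 1 \<Longrightarrow> distr M borel (Z i) = F"
    and f [measurable]: "f \<in> borel_measurable borel"
    and sq: "integrable F (\<lambda>z. (norm (f z))\<^sup>2)" and e: "\<epsilon> > 0"
  shows "(\<lambda>n. prob {\<omega> \<in> space M.
      norm ((1 / real n) *\<^sub>R (\<Sum>i=1..n. f (Z i \<omega>)) - (\<integral>z. f z \<partial>F)) > \<epsilon>}) \<longlonglongrightarrow> 0"
proof -
  have Z [measurable]: "Z i \<in> borel_measurable M" if "i \<ge> 1" for i
    using ind that by (auto simp: indep_vars_def)
  have "prob_space F" using prob_space_distr[OF Z[of 1]] distr[of 1] by simp
  then interpret F: prob_space F .
  have [measurable_cong]: "sets F = sets borel" using distr[of 1] by (metis order_refl sets_distr)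
  define \<delta> where "\<delta> = \<epsilon> / DIM('b)"
  have d: "\<delta> > 0" using e by (simp add: \<delta>_def)
  have "integrable F (\<lambda>z. norm (f z))"
    by (rule F.square_integrable_imp_integrable[OF _ sq]) measurable
  then have intf: "integrable F f" by (subst (asm) integrable_norm_iff) measurable
  let ?R = "\<lambda>n \<omega>. (1 / real n) *\<^sub>R (\<Sum>i=1..n. f (Z i \<omega>)) - (\<integral>z. f z \<partial>F)"
  let ?E = "\<lambda>b n. {\<omega> \<in> space M. \<bar>?R n \<omega> \<bullet> b\<bar> > \<delta>}"
  have lim: "(\<lambda>n. prob (?E b n)) \<longlonglongrightarrow> 0" if b: "b \<in> Basis" for b
  proof -
    have "integrable F (\<lambda>z. (f z \<bullet> b)\<^sup>2)"
      by (rule Bochner_Integration.integrable_bound[OF sq])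
        (use b in \<open>auto simp: Basis_le_norm abs_le_square_iff[symmetric]\<close>)
    from weak_law_real[OF ind distr _ this d] show ?thesis
      using intf by (simp add: inner_diff_left inner_sum_left)
  qed
  show ?thesis
  proof (rule Lim_null_comparison[OF always_eventually])
    show "(\<lambda>n. \<Sum>b\<in>Basis. prob (?E b n)) \<longlonglongrightarrow> 0"
      using tendsto_sum[of Basis "\<lambda>b n. prob (?E b n)" "\<lambda>_. 0"] lim by simp
    show "\<forall>n. norm (prob {\<omega> \<in> space M. norm (?R n \<omega>) > \<epsilon>}) \<le> (\<Sum>b\<in>Basis. prob (?E b n))"
    proof
      fix n
      have "prob {\<omega> \<in> space M. norm (?R n \<omega>) > \<epsilon>} \<le> prob (\<Union>b\<in>Basis. ?E b n)"
      proof (rule finite_measure_mono)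
        show "{\<omega> \<in> space M. norm (?R n \<omega>) > \<epsilon>} \<subseteq> (\<Union>b\<in>Basis. ?E b n)"
        proof (rule subsetI, rule ccontr)
          fix \<omega> assume w: "\<omega> \<in> {\<omega> \<in> space M. norm (?R n \<omega>) > \<epsilon>}" "\<omega> \<notin> (\<Union>b\<in>Basis. ?E b n)"
          have "norm (?R n \<omega>) \<le> (\<Sum>b\<in>Basis. \<bar>?R n \<omega> \<bullet> b\<bar>)" by (rule norm_le_l1)
          also have "\<dots> \<le> (\<Sum>b\<in>(Basis::'b set). \<delta>)"
            using w by (intro sum_mono) (auto simp: not_less)
          also have "\<dots> = \<epsilon>" by (simp add: \<delta>_def)
          finally show False using w by simp
        qed
        have "?E b n \<in> events" for b by measurable
        then show "(\<Union>b\<in>Basis. ?E b n) \<in> events" by (intro sets.finite_UN) auto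
      qed
      also have "\<dots> \<le> (\<Sum>b\<in>Basis. prob (?E b n))"
        by (rule finite_measure_subadditive_finite) auto
      finally show "norm (prob {\<omega> \<in> space M. norm (?R n \<omega>) > \<epsilon>}) \<le> (\<Sum>b\<in>Basis. prob (?E b n))"
        by simp
    qed
  qed
qed

section \<open>Roots depending on a parameter\<close>

text \<open>The root in \<open>x\<close> is the fixed point of the contraction \<open>x - B (h x l)\<close>.\<close>

lemma root_lipschitz_in_parameter:
  fixes h :: "'a::euclidean_space \<Rightarrow> real \<Rightarrow> 'a" and A B :: "'a \<Rightarrow> 'a"
  assumes B: "linear B" "\<And>x. B (A x) = x" "inj B" "\<And>x. norm (B x) \<le> b * norm x" "b > 0"
    and \<rho>: "\<rho> > 0" and c: "c \<ge> 0"
    and close: "\<And>x y l. x \<in> cball x0 \<rho> \<Longrightarrow> y \<in> cball x0 \<rho> \<Longrightarrow> \<bar>l - l0\<bar> \<le> \<sigma> \<Longrightarrow>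
      norm (h x l - h y l - A (x - y)) \<le> norm (x - y) / (2 * b)"
    and lip: "\<And>x l. x \<in> cball x0 \<rho> \<Longrightarrow> \<bar>l - l0\<bar> \<le> \<sigma> \<Longrightarrow> norm (h x l - h x l0) \<le> c * \<bar>l - l0\<bar>"
    and start: "norm (h x0 l0) \<le> \<rho> / (4 * b)"
    and \<sigma>: "b * c * \<sigma> \<le> \<rho> / 4" "\<sigma> \<ge> 0"
    and root: "\<And>x l. h x l = 0 \<longleftrightarrow> x = t l"
    and l: "\<bar>l - l0\<bar> \<le> \<sigma>"
  shows "norm (t l - t l0) \<le> 2 * b * c * \<bar>l - l0\<bar>"
proof -
  define g where "g l x = x - B (h x l)" for l x
  have contr: "norm (g k x - g k y) \<le> (1/2) * norm (x - y)"
    if "x \<in> cball x0 \<rho>" "y \<in> cball x0 \<rho>" "\<bar>k - l0\<bar> \<le> \<sigma>" for x y k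
  proof -
    \<comment> \<open>As \<open>B\<close> inverts \<open>A\<close>, the identity cancels and only
      the deviation of \<open>h\<close> from its linear model is left. It is at most
      \<open>norm (x - y) / (2 * b)\<close>, and \<open>B\<close> multiplies it by at most
      \<open>b\<close>: hence the contraction factor one half.\<close>
    have "g k x - g k y = - B (h x k - h y k - A (x - y))"
      using B(1,2) by (simp add: g_def linear_diff)
    then have "norm (g k x - g k y) \<le> b * norm (h x k - h y k - A (x - y))"
      using B(4) by simp
    also have "\<dots> \<le> b * (norm (x - y) / (2 * b))"
      using close[OF that] B(5) by (intro mult_left_mono) auto
    finally show ?thesis using B(5) by simp
  qed
  have shift: "norm (g k x - g l0 x) \<le> b * c * \<bar>k - l0\<bar>"
    if "x \<in> cball x0 \<rho>" "\<bar>k - l0\<bar> \<le> \<sigma>" for x k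
  proof -
    have "norm (g k x - g l0 x) = norm (B (h x k - h x l0))"
      using B(1) by (simp add: g_def linear_diff norm_minus_commute)
    also have "\<dots> \<le> b * norm (h x k - h x l0)" by (rule B(4))
    also have "\<dots> \<le> b * (c * \<bar>k - l0\<bar>)" using lip[OF that] B(5) by (intro mult_left_mono) auto
    finally show ?thesis by (simp add: mult.assoc)
  qed
  have x0: "x0 \<in> cball x0 \<rho>" using \<rho> by simp
  have loc: "t k \<in> cball x0 \<rho> \<and> g k (t k) = t k" if k: "\<bar>k - l0\<bar> \<le> \<sigma>" for k
  proof -
    have "\<exists>!x\<in>cball x0 \<rho>. g k x = x"
    proof (rule Banach_fix[where c="1/2"])
      show "g k ` cball x0 \<rho> \<subseteq> cball x0 \<rho>"
      proof safe
        fix x assume x: "x \<in> cball x0 \<rho>"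
        \<comment> \<open>The radius budget: \<rho>/4 for moving the parameter from
          \<open>l0\<close> to \<open>k\<close>, \<rho>/4 for the first Newton step from
          \<open>x0\<close>, and \<rho>/2 for the contraction. The fours in \<open>start\<close> and
          in the bound on \<sigma> come from here.\<close>
        have "b * c * \<bar>k - l0\<bar> \<le> b * c * \<sigma>"
          using k B(5) c by (intro mult_left_mono) auto
        then have 1: "norm (g k x0 - g l0 x0) \<le> \<rho> / 4"
          using shift[OF x0 k] \<sigma> by linarith
        have "norm (g l0 x0 - x0) \<le> b * norm (h x0 l0)" using B(4) by (simp add: g_def)
        also have "\<dots> \<le> b * (\<rho> / (4 * b))" using start B(5) by (intro mult_left_mono) auto
        finally have 2: "norm (g l0 x0 - x0) \<le> \<rho> / 4" using B(5) by simp
        have "norm (x - x0) \<le> \<rho>" using x by (simp add: dist_norm norm_minus_commute)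
        with contr[OF x x0 k] have 3: "norm (g k x - g k x0) \<le> \<rho> / 2" by linarith
        have "norm (g k x - x0) \<le> norm (g k x - g k x0) + norm (g k x0 - x0)"
          using norm_triangle_ineq[of "g k x - g k x0" "g k x0 - x0"] by simp
        moreover have "norm (g k x0 - x0) \<le> norm (g k x0 - g l0 x0) + norm (g l0 x0 - x0)"
          using norm_triangle_ineq[of "g k x0 - g l0 x0" "g l0 x0 - x0"] by simp
        ultimately show "g k x \<in> cball x0 \<rho>"
          using 1 2 3 by (simp add: dist_norm norm_minus_commute[of x0])
      qed
      show "dist (g k x) (g k y) \<le> 1 / 2 * dist x y" if "x \<in> cball x0 \<rho>" "y \<in> cball x0 \<rho>" for x y
        using contr[OF that k] by (simp add: dist_norm)
    qed (use \<rho> in \<open>auto simp: complete_eq_closed\<close>)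
    \<comment> \<open>A fixed point has \<open>B (h x k) = 0\<close>, so injectivity makes it a
      root, and uniqueness of the root identifies it with \<open>t k\<close>, which is thereby
      located in the ball.\<close>
    then obtain x where x: "x \<in> cball x0 \<rho>" "g k x = x" by auto
    then have "B (h x k) = B 0" using B(1) by (simp add: g_def linear_0)
    then have "h x k = 0" using B(3) by (auto dest: injD)
    with x root show ?thesis by auto
  qed
  have l0: "\<bar>l0 - l0\<bar> \<le> \<sigma>" using \<sigma>(2) by simp
  \<comment> \<open>Both roots are fixed points. The contracted part is absorbed into the left-hand
    side, which doubles the constant of the parameter shift.\<close>
  have "t l - t l0 = (g l (t l) - g l (t l0)) + (g l (t l0) - g l0 (t l0))"
    using loc[OF l] loc[OF l0] by simp
  then have "norm (t l - t l0) \<le> norm (g l (t l) - g l (t l0)) + norm (g l (t l0) - g l0 (t l0))"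
    by (metis norm_triangle_ineq)
  also have "\<dots> \<le> (1/2) * norm (t l - t l0) + b * c * \<bar>l - l0\<bar>"
    using contr[of "t l" "t l0" l] shift[of "t l0" l] loc[OF l] loc[OF l0] l by (intro add_mono) auto
  finally show ?thesis by linarith
qed

section \<open>Differentiability and measurability\<close>

lemma sets_norm_affine_gt:
  fixes g :: "'a \<Rightarrow> 'b::euclidean_space"
  assumes [measurable]: "g \<in> borel_measurable M"
  shows "{\<omega> \<in> space M. norm (k *\<^sub>R g \<omega> - c) > d} \<in> sets M"
  by measurable

text \<open>Step lengths \<open>1 / Suc k\<close> turn a directional derivative into a limit along a
  sequence. This form gives measurability of derivatives in the data point and suits dominated
  convergence.\<close>

lemma has_derivative_quotient_limit:
  assumes "(f has_derivative f') (at x)"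
  shows "(\<lambda>k. real (Suc k) *\<^sub>R (f (x + (1 / real (Suc k)) *\<^sub>R u) - f x)) \<longlonglongrightarrow> f' u"
proof (cases "u = 0")
  case True
  then show ?thesis using has_derivative_linear[OF assms] by (simp add: linear_0)
next
  case False
  let ?h = "\<lambda>k. (1 / real (Suc k)) *\<^sub>R u"
  have "?h \<longlonglongrightarrow> 0 *\<^sub>R u" by (intro tendsto_intros LIMSEQ_Suc lim_const_over_n)
  then have "filterlim ?h (at 0) sequentially"
    using False by (simp add: filterlim_at)
  moreover have "((\<lambda>h. norm (f (x + h) - f x - f' h) / norm h) \<longlongrightarrow> 0) (at 0)"
    using assms by (simp add: has_derivative_at)
  ultimately have "(\<lambda>k. norm (f (x + ?h k) - f x - f' (?h k)) / norm (?h k)) \<longlonglongrightarrow> 0"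
    by (rule filterlim_compose[rotated])
  then have "(\<lambda>k. norm u * (norm (f (x + ?h k) - f x - f' (?h k)) / norm (?h k))) \<longlonglongrightarrow> 0"
    using tendsto_mult_right_zero by blast
  moreover have "norm u * (norm (f (x + ?h k) - f x - f' (?h k)) / norm (?h k)) =
      norm (real (Suc k) *\<^sub>R (f (x + ?h k) - f x) - f' u)" for k
  proof -
    have "real (Suc k) *\<^sub>R (f (x + ?h k) - f x) - f' u =
        real (Suc k) *\<^sub>R (f (x + ?h k) - f x - f' (?h k))"
      using has_derivative_linear[OF assms]
      by (simp add: linear_scale scaleR_diff_right del: of_nat_Suc)
    then have "norm (real (Suc k) *\<^sub>R (f (x + ?h k) - f x) - f' u) =
        real (Suc k) * norm (f (x + ?h k) - f x - f' (?h k))"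
      by (simp only: norm_scaleR abs_of_nat)
    moreover have "norm (?h k) = norm u / real (Suc k)" by simp
    ultimately show ?thesis using False by (simp only: field_simps) simp
  qed
  ultimately have "(\<lambda>k. norm (real (Suc k) *\<^sub>R (f (x + ?h k) - f x) - f' u)) \<longlonglongrightarrow> 0"
    by simp
  then show ?thesis by (subst (asm) tendsto_norm_zero_iff) (rule LIM_zero_cancel)
qed

lemma borel_measurable_directional_derivative:
  fixes f :: "'z \<Rightarrow> 'a::real_normed_vector \<Rightarrow> 'b::{real_normed_vector, second_countable_topology}"
  assumes "\<And>z. (f z has_derivative f' z) (at x)"
    and [measurable]: "\<And>y. (\<lambda>z. f z y) \<in> borel_measurable M"
  shows "(\<lambda>z. f' z u) \<in> borel_measurable M"
  by (rule borel_measurable_LIMSEQ_metric[OF _ has_derivative_quotient_limit[OF assms(1)]]) measurable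

text \<open>The domination hypothesis bounds partial derivatives entry by entry, while the mean
  value inequality asks for an operator norm. The crude dimension factor pays for the
  passage.\<close>

lemma norm_linear_le_entries:
  fixes f :: "'a::euclidean_space \<Rightarrow> 'b::euclidean_space"
  assumes "linear f" and M: "\<And>b c. b \<in> Basis \<Longrightarrow> c \<in> Basis \<Longrightarrow> \<bar>f b \<bullet> c\<bar> \<le> M"
  shows "norm (f h) \<le> real (DIM('a) * DIM('b)) * M * norm h"
proof -
  have fb: "norm (f b) \<le> real (DIM('b)) * M" if "b \<in> Basis" for b
  proof -
    have "norm (f b) \<le> (\<Sum>c\<in>Basis. \<bar>f b \<bullet> c\<bar>)" by (rule norm_le_l1)
    also have "\<dots> \<le> (\<Sum>c\<in>(Basis::'b set). M)" by (intro sum_mono M that)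
    finally show ?thesis by simp
  qed
  have "f h = f (\<Sum>b\<in>Basis. (h \<bullet> b) *\<^sub>R b)" by (simp add: euclidean_representation)
  also have "\<dots> = (\<Sum>b\<in>Basis. (h \<bullet> b) *\<^sub>R f b)"
    using assms(1) by (simp add: linear_sum linear_scale)
  finally have "norm (f h) \<le> (\<Sum>b\<in>Basis. norm ((h \<bullet> b) *\<^sub>R f b))" by (simp only:) (rule norm_sum)
  also have "\<dots> \<le> (\<Sum>b\<in>(Basis::'a set). norm h * (real (DIM('b)) * M))"
    by (intro sum_mono) (auto intro!: mult_mono fb Basis_le_norm)
  finally show ?thesis by (simp add: algebra_simps)
qed

text \<open>The norm of a matrix in this type is the Frobenius norm; Cauchy-Schwarz in each row
  suffices.\<close>

lemma norm_matrix_vector_mult_le: "norm (A *v x) \<le> norm A * norm x"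
  for A :: "real^'n^'m"
proof -
  have "norm (A *v x) = L2_set (\<lambda>i. norm (A $ i \<bullet> x)) UNIV"
    by (simp add: norm_vec_def matrix_vector_mul_component)
  also have "\<dots> \<le> L2_set (\<lambda>i. norm (A $ i) * norm x) UNIV"
    by (rule L2_set_mono) (auto simp: Cauchy_Schwarz_ineq2)
  also have "\<dots> = norm A * norm x"
    by (simp add: norm_vec_def L2_set_left_distrib)
  finally show ?thesis .
qed

text \<open>\<open>grad\<close> is a definite description, so existence and uniqueness must come
  first. The representing vector is assembled from the values of the derivative on the basis, and it
  is unique because the inner product separates vectors.\<close>

lemma gderiv_grad:
  fixes f :: "'a::euclidean_space \<Rightarrow> real"
  assumes "f differentiable (at x)"
  shows "(f has_derivative (\<lambda>h. h \<bullet> grad f x)) (at x)"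
proof -
  obtain f' where f': "(f has_derivative f') (at x)"
    using assms by (auto simp: differentiable_def)
  interpret linear f' using f' by (rule has_derivative_linear)
  have "f' = (\<lambda>h. h \<bullet> (\<Sum>b\<in>Basis. f' b *\<^sub>R b))"
  proof
    fix h
    have "f' h = f' (\<Sum>b\<in>Basis. (h \<bullet> b) *\<^sub>R b)" by (simp add: euclidean_representation)
    also have "\<dots> = h \<bullet> (\<Sum>b\<in>Basis. f' b *\<^sub>R b)"
      by (simp add: sum scale inner_sum_right mult.commute)
    finally show "f' h = h \<bullet> (\<Sum>b\<in>Basis. f' b *\<^sub>R b)" .
  qed
  with f' have ex: "GDERIV f x :> (\<Sum>b\<in>Basis. f' b *\<^sub>R b)" (is "GDERIV _ _ :> ?D")
    unfolding gderiv_def by simp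
  have uniq: "D = ?D" if "GDERIV f x :> D" for D
  proof -
    have "(\<lambda>h. h \<bullet> D) = (\<lambda>h. h \<bullet> ?D)"
      using that ex unfolding gderiv_def by (rule has_derivative_unique)
    then have "\<forall>h. h \<bullet> D = h \<bullet> ?D" by (rule fun_cong[THEN allI])
    then show ?thesis by (simp only: vector_eq_ldot)
  qed
  have "GDERIV f x :> grad f x" unfolding grad_def by (rule theI[of "\<lambda>D. GDERIV f x :> D", OF ex uniq])
  then show ?thesis by (simp add: gderiv_def)
qed

text \<open>Smoothness is assumed jointly, but \<open>eta\<close> is written with partial
  derivatives. The joint derivative is split by linearity along the two factors, and uniqueness of
  derivatives identifies the pieces with the Jacobian and the vector derivative.\<close>

lemma has_derivative_jacobian_parameter:
  fixes \<phi> :: "real^'p \<Rightarrow> real \<Rightarrow> real^'q"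
  assumes "(\<lambda>(\<theta>, l). \<phi> \<theta> l) differentiable (at (\<theta>, l))"
  shows "((\<lambda>(\<theta>, l). \<phi> \<theta> l) has_derivative
      (\<lambda>(u, s). jacobian (\<lambda>\<theta>. \<phi> \<theta> l) (at \<theta>) *v u + s *\<^sub>R vector_derivative (\<phi> \<theta>) (at l))) (at (\<theta>, l))"
    and "((\<lambda>\<theta>. \<phi> \<theta> l) has_derivative (*v) (jacobian (\<lambda>\<theta>. \<phi> \<theta> l) (at \<theta>))) (at \<theta>)"
    and "(\<phi> \<theta> has_vector_derivative vector_derivative (\<phi> \<theta>) (at l)) (at l)"
proof -
  obtain f' where f': "((\<lambda>(\<theta>, l). \<phi> \<theta> l) has_derivative f') (at (\<theta>, l))"
    using assms by (auto simp: differentiable_def)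
  interpret linear f' using f' by (rule has_derivative_linear)
  have t: "((\<lambda>\<theta>. \<phi> \<theta> l) has_derivative (\<lambda>u. f' (u, 0))) (at \<theta>)"
    using has_derivative_compose[OF has_derivative_Pair[OF has_derivative_ident has_derivative_const] f'] by simp
  have p: "(\<phi> \<theta> has_derivative (\<lambda>s. f' (0, s))) (at l)"
    using has_derivative_compose[OF has_derivative_Pair[OF has_derivative_const has_derivative_ident] f'] by simp
  have p_eq: "(\<lambda>s. f' (0, s)) = (\<lambda>s. s *\<^sub>R f' (0, 1))"
  proof
    show "f' (0, s) = s *\<^sub>R f' (0, 1)" for s using scale[of s "(0, 1)"] by simp
  qed
  have "(\<phi> \<theta> has_vector_derivative f' (0, 1)) (at l)"
    using p unfolding has_vector_derivative_def p_eq .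
  then show vd: "(\<phi> \<theta> has_vector_derivative vector_derivative (\<phi> \<theta>) (at l)) (at l)"
    by (metis vector_derivative_at)
  show jd: "((\<lambda>\<theta>. \<phi> \<theta> l) has_derivative (*v) (jacobian (\<lambda>\<theta>. \<phi> \<theta> l) (at \<theta>))) (at \<theta>)"
    using t jacobian_works[of "\<lambda>\<theta>. \<phi> \<theta> l" "at \<theta>"] by (auto simp: differentiable_def)
  have "f' (u, s) = jacobian (\<lambda>\<theta>. \<phi> \<theta> l) (at \<theta>) *v u + s *\<^sub>R vector_derivative (\<phi> \<theta>) (at l)" for u s
  proof -
    have "f' (u, s) = f' (u, 0) + f' (0, s)" using add[of "(u, 0)" "(0, s)"] by simp
    moreover have "f' (u, 0) = jacobian (\<lambda>\<theta>. \<phi> \<theta> l) (at \<theta>) *v u"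
      using has_derivative_unique[OF t jd] by metis
    moreover have "f' (0, s) = s *\<^sub>R vector_derivative (\<phi> \<theta>) (at l)"
      using has_derivative_unique[OF p vd[unfolded has_vector_derivative_def]] by metis
    ultimately show ?thesis by simp
  qed
  then have "f' = (\<lambda>(u, s). jacobian (\<lambda>\<theta>. \<phi> \<theta> l) (at \<theta>) *v u + s *\<^sub>R vector_derivative (\<phi> \<theta>) (at l))"
    by auto
  with f' show "((\<lambda>(\<theta>, l). \<phi> \<theta> l) has_derivative
      (\<lambda>(u, s). jacobian (\<lambda>\<theta>. \<phi> \<theta> l) (at \<theta>) *v u + s *\<^sub>R vector_derivative (\<phi> \<theta>) (at l))) (at (\<theta>, l))"
    by simp
qed

section \<open>Dominated estimating functions\<close>

text \<open>The neighbourhood of \<alpha>0 is replaced by a product of balls, so that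
  \<open>D\<close> can move while \<theta> and \<open>l\<close> stay put; this separates the
  Jacobian from the parameter derivative. In \<open>eta_lipschitz\<close> both points share
  \<open>D\<close>, since a modulus of continuity is wanted in \<theta> and \<open>l\<close>
  alone.\<close>

locale eta_box =
  fixes \<phi> :: "'z::topological_space \<Rightarrow> real^'p \<Rightarrow> real \<Rightarrow> real^'p"
    and \<psi> :: "'z \<Rightarrow> real^'p \<Rightarrow> real"
    and F :: "'z measure"
    and \<theta>s Ds :: "real^'p" and l0 r C :: real
    and m0 m1 :: "'z \<Rightarrow> real"
  assumes F: "prob_space F" and sets_F [measurable_cong]: "sets F = sets borel"
    and measurable_phi [measurable]: "\<And>\<theta> l. (\<lambda>z. \<phi> z \<theta> l) \<in> borel_measurable borel"
    and measurable_psi [measurable]: "\<And>\<theta>. (\<lambda>z. \<psi> z \<theta>) \<in> borel_measurable borel"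
    and smooth_phi: "\<And>z \<theta> l. (\<lambda>(\<theta>, l). \<phi> z \<theta> l) differentiable (at (\<theta>, l))"
    and smooth_psi: "\<And>z \<theta>. \<psi> z differentiable (at \<theta>)"
    and r: "r > 0" and C: "C \<ge> 0"
    and m0 [measurable]: "m0 \<in> borel_measurable borel" and m0_sq: "integrable F (\<lambda>z. (m0 z)\<^sup>2)"
    and m1 [measurable]: "m1 \<in> borel_measurable borel" and m1_sq: "integrable F (\<lambda>z. (m1 z)\<^sup>2)"
    and m1_nonneg: "\<And>z. m1 z \<ge> 0"
    and eta_bound: "\<And>z \<theta> l D. \<theta> \<in> cball \<theta>s r \<Longrightarrow> l \<in> cball l0 r \<Longrightarrow> D \<in> cball Ds r \<Longrightarrow>
      norm (eta \<phi> \<psi> z (\<theta>, l, D)) \<le> m0 z"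
    and eta_lipschitz: "\<And>z \<theta> l D \<theta>' l'. \<theta> \<in> cball \<theta>s r \<Longrightarrow> l \<in> cball l0 r \<Longrightarrow> D \<in> cball Ds r \<Longrightarrow>
      \<theta>' \<in> cball \<theta>s r \<Longrightarrow> l' \<in> cball l0 r \<Longrightarrow>
      norm (eta \<phi> \<psi> z (\<theta>, l, D) - eta \<phi> \<psi> z (\<theta>', l', D)) \<le> C * m1 z * (norm (\<theta> - \<theta>') + \<bar>l - l'\<bar>)"
begin

abbreviation J where "J z \<theta> l \<equiv> jacobian (\<lambda>\<theta>. \<phi> z \<theta> l) (at \<theta>)"
abbreviation L where "L z \<theta> l \<equiv> vector_derivative (\<phi> z \<theta>) (at l)"

lemma eta3: "snd (snd (eta \<phi> \<psi> z (\<theta>, l, D))) = J z \<theta> l *v D + L z \<theta> l"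
  by (simp add: eta_def)

lemma norm_snd_snd_le: "norm (snd (snd x)) \<le> norm x"
  by (cases x) (auto intro: order_trans[OF norm_snd_le norm_snd_le])

lemma m0_nonneg: "m0 z \<ge> 0"
  using order_trans[OF norm_ge_zero eta_bound[of \<theta>s l0 Ds z]] r by simp

lemma integrable_m0: "integrable F m0"
proof -
  interpret prob_space F by (rule F)
  show ?thesis by (rule square_integrable_imp_integrable[OF _ m0_sq]) measurable
qed

lemma integrable_dominated:
  fixes f :: "'z \<Rightarrow> 'b::{banach, second_countable_topology}"
  assumes [measurable]: "f \<in> borel_measurable borel" and "\<And>z. norm (f z) \<le> c * m0 z"
  shows "integrable F f"
proof (rule Bochner_Integration.integrable_bound[where f="\<lambda>z. c * m0 z"])
  show "integrable F (\<lambda>z. c * m0 z)" using integrable_m0 by simp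
  show "AE z in F. norm (f z) \<le> norm (c * m0 z)" using order_trans[OF assms(2) abs_ge_self] by auto
qed measurable

section \<open>Bounds on the derivatives of the estimating function\<close>

text \<open>Increments of \<open>D\<close> are confined to radius \<open>r\<close>, so a linear map
  is first bounded on short vectors; homogeneity extends the bound at the price of a factor
  \<open>1 / r\<close>.\<close>

lemma norm_le_by_scaling:
  fixes X :: "real^'p^'p"
  assumes "\<And>w. norm w \<le> r \<Longrightarrow> norm (X *v w) \<le> b"
  shows "norm (X *v u) \<le> b / r * norm u"
proof (cases "u = 0")
  case False
  define w where "w = (r / norm u) *\<^sub>R u"
  have "norm w \<le> r" using False r by (simp add: w_def)
  from assms[OF this] have "norm (X *v w) \<le> b" .
  moreover have "norm (X *v w) = r / norm u * norm (X *v u)"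
    using r by (simp add: w_def matrix_vector_mult_scaleR)
  ultimately show ?thesis using False r by (simp add: field_simps)
qed simp

text \<open>The third block of \<open>eta\<close> is affine in \<open>D\<close> with linear part \<open>J\<close>. Its differences in \<open>D\<close> over
  the box recover \<open>J\<close>, so \<open>m0\<close> and \<open>m1\<close> control the size and the modulus of continuity of \<open>J\<close>.\<close>

lemma jacobian_bound:
  assumes "\<theta> \<in> cball \<theta>s r" "l \<in> cball l0 r"
  shows "norm (J z \<theta> l *v u) \<le> 2 / r * m0 z * norm u"
proof -
  have "norm (J z \<theta> l *v w) \<le> 2 * m0 z" if "norm w \<le> r" for w
  proof -
    have "J z \<theta> l *v w = snd (snd (eta \<phi> \<psi> z (\<theta>, l, Ds + w))) - snd (snd (eta \<phi> \<psi> z (\<theta>, l, Ds)))"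
      by (simp add: eta3 matrix_vector_right_distrib)
    also have "norm \<dots> \<le> m0 z + m0 z"
      using that r by (intro norm_triangle_le_diff add_mono order_trans[OF norm_snd_snd_le eta_bound] assms)
        (auto simp: dist_norm)
    finally show ?thesis by simp
  qed
  from norm_le_by_scaling[OF this] show ?thesis by simp
qed

text \<open>The parameter derivative is the third block at \<open>Ds\<close> minus
  \<open>J *v Ds\<close>: the block contributes the 1, and the Jacobian bound contributes the
  rest.\<close>

definition cL where "cL = 1 + 2 / r * norm Ds"

lemma cL_pos: "cL > 0"
  using r by (auto simp: cL_def intro!: add_pos_nonneg divide_nonneg_pos)

lemma parameter_derivative_bound:
  assumes "\<theta> \<in> cball \<theta>s r" "l \<in> cball l0 r"
  shows "norm (L z \<theta> l) \<le> cL * m0 z"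
proof -
  have "L z \<theta> l = snd (snd (eta \<phi> \<psi> z (\<theta>, l, Ds))) - J z \<theta> l *v Ds"
    by (simp add: eta3)
  also have "norm \<dots> \<le> m0 z + 2 / r * m0 z * norm Ds"
    using r by (intro norm_triangle_le_diff add_mono jacobian_bound order_trans[OF norm_snd_snd_le eta_bound] assms)
      auto
  finally show ?thesis by (simp add: cL_def algebra_simps)
qed

lemma jacobian_lipschitz:
  assumes "\<theta> \<in> cball \<theta>s r" "l \<in> cball l0 r"
  shows "norm (J z \<theta> l *v u - J z \<theta>s l0 *v u)
    \<le> 2 * C / r * m1 z * (norm (\<theta> - \<theta>s) + \<bar>l - l0\<bar>) * norm u"
proof -
  let ?e = "\<lambda>\<theta> l D. snd (snd (eta \<phi> \<psi> z (\<theta>, l, D)))"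
  let ?b = "C * m1 z * (norm (\<theta> - \<theta>s) + \<bar>l - l0\<bar>)"
  have e: "norm (?e \<theta> l D - ?e \<theta>s l0 D) \<le> ?b" if "D \<in> cball Ds r" for D
    using order_trans[OF norm_snd_snd_le eta_lipschitz[OF assms that, of \<theta>s l0 z]] r by simp
  have "norm ((J z \<theta> l - J z \<theta>s l0) *v w) \<le> 2 * ?b" if "norm w \<le> r" for w
  proof -
    \<comment> \<open>A mixed second difference: the parameter derivatives cancel between
      \<open>Ds + w\<close> and \<open>Ds\<close>. The grouping puts a common \<open>D\<close> in
      each bracket, so the Lipschitz bound applies twice.\<close>
    have "(J z \<theta> l - J z \<theta>s l0) *v w =
        (?e \<theta> l (Ds + w) - ?e \<theta>s l0 (Ds + w)) - (?e \<theta> l Ds - ?e \<theta>s l0 Ds)"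
      by (simp add: eta3 matrix_vector_right_distrib matrix_vector_mult_diff_rdistrib)
    also have "norm \<dots> \<le> ?b + ?b"
      using that r by (intro norm_triangle_le_diff add_mono e) (auto simp: dist_norm)
    finally show ?thesis by simp
  qed
  from norm_le_by_scaling[OF this] show ?thesis
    by (simp add: matrix_vector_mult_diff_rdistrib mult.assoc)
qed

text \<open>Both partial derivatives of \<phi> are controlled by the size of the third block of
  \<open>eta\<close>, so the Lipschitz constant is a multiple of \<open>m0\<close>. The path changes
  \<theta> first and \<open>l\<close> afterwards, which keeps it inside the box.\<close>

lemma phi_lipschitz:
  assumes \<theta>: "\<theta> \<in> cball \<theta>s r" "\<theta>' \<in> cball \<theta>s r" and l: "l \<in> cball l0 r" "l' \<in> cball l0 r"
  shows "norm (\<phi> z \<theta> l - \<phi> z \<theta>' l') \<le> (2 / r * norm (\<theta> - \<theta>') + cL * \<bar>l - l'\<bar>) * m0 z"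
proof -
  have "norm (\<phi> z \<theta> l - \<phi> z \<theta>' l) \<le> (2 / r * m0 z) * norm (\<theta> - \<theta>')"
  proof (rule differentiable_bound[OF convex_cball[of \<theta>s r]])
    fix x assume x: "x \<in> cball \<theta>s r"
    show "((\<lambda>\<theta>. \<phi> z \<theta> l) has_derivative (*v) (J z x l)) (at x within cball \<theta>s r)"
      by (rule has_derivative_at_withinI[OF has_derivative_jacobian_parameter(2)[OF smooth_phi]])
    show "onorm ((*v) (J z x l)) \<le> 2 / r * m0 z"
      using r m0_nonneg[of z] by (intro onorm_bound jacobian_bound x l) auto
  qed (use \<theta> in auto)
  moreover have "norm (\<phi> z \<theta>' l - \<phi> z \<theta>' l') \<le> (cL * m0 z) * norm (l - l')"
  proof (rule differentiable_bound[OF convex_cball[of l0 r]])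
    fix k assume k: "k \<in> cball l0 r"
    show "(\<phi> z \<theta>' has_derivative (\<lambda>s. s *\<^sub>R L z \<theta>' k)) (at k within cball l0 r)"
      by (rule has_derivative_at_withinI[OF has_derivative_jacobian_parameter(3)[OF smooth_phi, unfolded has_vector_derivative_def]])
    have "norm (s *\<^sub>R L z \<theta>' k) \<le> cL * m0 z * norm s" for s
      using mult_left_mono[OF parameter_derivative_bound[OF \<theta>(2) k], of "\<bar>s\<bar>" z] by (simp add: mult.commute)
    then show "onorm (\<lambda>s. s *\<^sub>R L z \<theta>' k) \<le> cL * m0 z"
      using cL_pos m0_nonneg[of z] by (intro onorm_bound) auto
  qed (use l in auto)
  moreover have "norm (\<phi> z \<theta> l - \<phi> z \<theta>' l') \<le>
      norm (\<phi> z \<theta> l - \<phi> z \<theta>' l) + norm (\<phi> z \<theta>' l - \<phi> z \<theta>' l')"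
    using norm_triangle_ineq[of "\<phi> z \<theta> l - \<phi> z \<theta>' l" "\<phi> z \<theta>' l - \<phi> z \<theta>' l'"] by simp
  ultimately show ?thesis by (simp add: algebra_simps)
qed

section \<open>Measurability, integrability and the mean Jacobian\<close>

lemma measurable_jacobian_apply [measurable]: "(\<lambda>z. J z \<theta> l *v u) \<in> borel_measurable borel"
  by (rule borel_measurable_directional_derivative
      [OF has_derivative_jacobian_parameter(2)[OF smooth_phi]]) measurable

lemma measurable_parameter_derivative [measurable]: "(\<lambda>z. L z \<theta> l) \<in> borel_measurable borel"
proof -
  have "(\<lambda>z. 1 *\<^sub>R L z \<theta> l) \<in> borel_measurable borel"
    by (rule borel_measurable_directional_derivative
        [OF has_derivative_jacobian_parameter(3)[OF smooth_phi, unfolded has_vector_derivative_def]]) measurable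
  then show ?thesis by simp
qed

lemma jacobian_entry: "J z \<theta> l \<bullet> axis i (axis j 1) = (J z \<theta> l *v axis j 1) $ i"
  by (simp add: inner_axis matrix_vector_mul_component)

lemma measurable_jacobian [measurable]: "(\<lambda>z. J z \<theta> l) \<in> borel_measurable borel"
proof (subst borel_measurable_euclidean_space, intro ballI)
  fix b :: "real^'p^'p" assume "b \<in> Basis"
  then obtain i j where "b = axis i (axis j 1)" by (auto simp: Basis_vec_def)
  then show "(\<lambda>z. J z \<theta> l \<bullet> b) \<in> borel_measurable borel"
    by (simp only: jacobian_entry cart_eq_inner_axis) measurable
qed

text \<open>Each entry is a component of \<open>J\<close> applied to a basis vector and so obeys
  \<open>jacobian_bound\<close>; summing the entries gives the dimension factor. This makes the
  matrix-valued \<open>J\<close> square integrable, as the weak law requires.\<close>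

lemma norm_jacobian_le:
  assumes "\<theta> \<in> cball \<theta>s r" "l \<in> cball l0 r"
  shows "norm (J z \<theta> l) \<le> DIM(real^'p^'p) * (2 / r) * m0 z"
proof -
  have "norm (J z \<theta> l) \<le> (\<Sum>b\<in>Basis. \<bar>J z \<theta> l \<bullet> b\<bar>)" by (rule norm_le_l1)
  also have "\<dots> \<le> (\<Sum>b\<in>(Basis :: (real^'p^'p) set). 2 / r * m0 z)"
  proof (rule sum_mono)
    fix b :: "real^'p^'p" assume "b \<in> Basis"
    then obtain i j where b: "b = axis i (axis j 1)" by (auto simp: Basis_vec_def)
    show "\<bar>J z \<theta> l \<bullet> b\<bar> \<le> 2 / r * m0 z"
      unfolding b jacobian_entry
      using order_trans[OF component_le_norm_cart jacobian_bound[OF assms, of z "axis j 1"]] by simp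
  qed
  finally show ?thesis by (simp only: sum_constant mult.assoc)
qed

lemma measurable_eta [measurable]: "(\<lambda>z. eta \<phi> \<psi> z \<alpha>) \<in> borel_measurable borel"
proof -
  obtain \<theta> l D where \<alpha>: "\<alpha> = (\<theta>, l, D)" by (cases \<alpha>)
  have [measurable]: "(\<lambda>z. D \<bullet> grad (\<psi> z) \<theta>) \<in> borel_measurable borel"
    by (rule borel_measurable_directional_derivative[OF gderiv_grad[OF smooth_psi]]) measurable
  show ?thesis unfolding \<alpha> eta_def prod.case by measurable
qed

lemma integrable_eta:
  assumes "\<theta> \<in> cball \<theta>s r" "l \<in> cball l0 r" "D \<in> cball Ds r"
  shows "integrable F (\<lambda>z. eta \<phi> \<psi> z (\<theta>, l, D))"
  by (rule integrable_dominated[where c=1]) (use eta_bound[OF assms] in auto)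

definition A where "A = (\<integral>z. J z \<theta>s l0 \<partial>F)"

lemma integrable_jacobian: "integrable F (\<lambda>z. J z \<theta>s l0)"
  by (rule integrable_dominated[OF measurable_jacobian norm_jacobian_le]) (use r in auto)

lemma bounded_linear_apply: "bounded_linear (\<lambda>X :: real^'p^'p. X *v u)"
  by (rule bounded_linear_intro[where K="norm u"])
    (auto simp: matrix_vector_mult_add_rdistrib scaleR_matrix_vector_assoc norm_matrix_vector_mult_le)

lemma integral_jacobian_apply: "(\<integral>z. J z \<theta>s l0 *v u \<partial>F) = A *v u"
  unfolding A_def by (rule integral_bounded_linear[OF bounded_linear_apply integrable_jacobian])

lemma fst_Psi:
  assumes "\<theta> \<in> cball \<theta>s r" "l \<in> cball l0 r" "D \<in> cball Ds r"
  shows "fst (Psi \<phi> \<psi> F (\<theta>, l, D)) = (\<integral>z. \<phi> z \<theta> l \<partial>F)"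
  unfolding Psi_def
  by (subst integral_bounded_linear[OF bounded_linear_fst integrable_eta[OF assms], symmetric])
    (simp add: eta_def)

lemma norm_phi_le:
  assumes "\<theta> \<in> cball \<theta>s r" "l \<in> cball l0 r"
  shows "norm (\<phi> z \<theta> l) \<le> m0 z"
  using eta_bound[OF assms, of Ds z] r
    norm_fst_le[of "\<phi> z \<theta> l" "snd (eta \<phi> \<psi> z (\<theta>, l, Ds))"]
  by (simp add: eta_def)

lemma integrable_phi:
  assumes "\<theta> \<in> cball \<theta>s r" "l \<in> cball l0 r"
  shows "integrable F (\<lambda>z. \<phi> z \<theta> l)"
  by (rule integrable_dominated[where c=1]) (use norm_phi_le[OF assms] in auto)

end

text \<open>At the root \<open>\<alpha>0\<close> the third block gives \<open>E L = - A D\<close>. A left null vector \<open>v\<close> of \<open>A\<close> thus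
  annihilates the whole first block row \<open>(A, E L, 0)\<close> of the derivative of \<open>Psi\<close>.\<close>

lemma (in eta_box) invertible_jacobian:
  assumes root: "Psi \<phi> \<psi> F (\<theta>s, l0, Ds) = 0"
    and P: "(Psi \<phi> \<psi> F has_derivative P) (at (\<theta>s, l0, Ds))" and surj: "surj P"
  shows "invertible A"
proof (rule ccontr)
  assume "\<not> invertible A"
  \<comment> \<open>A left inverse of \<open>transpose A\<close> would transpose to a right inverse
    of \<open>A\<close>. Without one, \<open>transpose A\<close> has a nonzero kernel vector
    \<open>v\<close>, which is orthogonal to the range of \<open>A\<close>.\<close>
  have "B ** transpose A \<noteq> mat 1" for B
  proof
    assume "B ** transpose A = mat 1"
    then have "transpose (B ** transpose A) = mat 1" by (simp add: transpose_mat)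
    then have "A ** transpose B = mat 1" by (simp add: matrix_transpose_mul)
    with \<open>\<not> invertible A\<close> show False using invertible_right_inverse by blast
  qed
  then obtain v where v: "v \<noteq> 0" "transpose A *v v = 0"
    using matrix_left_invertible_ker[of "transpose A"] by auto
  have vA: "v \<bullet> (A *v u) = 0" for u
    using v(2) dot_lmul_matrix[of v A u] by simp
  have c: "\<theta>s \<in> cball \<theta>s r" "l0 \<in> cball l0 r" "Ds \<in> cball Ds r" using r by auto
  have intL: "integrable F (\<lambda>z. L z \<theta>s l0)"
    by (rule integrable_dominated[OF measurable_parameter_derivative parameter_derivative_bound[OF c(1,2)]])
  have intJ: "integrable F (\<lambda>z. J z \<theta>s l0 *v u)" for u
    by (rule integrable_bounded_linear[OF bounded_linear_apply integrable_jacobian])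
  have "snd (snd (Psi \<phi> \<psi> F (\<theta>s, l0, Ds))) = (\<integral>z. snd (snd (eta \<phi> \<psi> z (\<theta>s, l0, Ds))) \<partial>F)"
    unfolding Psi_def
    by (rule integral_bounded_linear[OF bounded_linear_compose[OF bounded_linear_snd bounded_linear_snd]
        integrable_eta[OF c], symmetric])
  also have "\<dots> = A *v Ds + (\<integral>z. L z \<theta>s l0 \<partial>F)"
    using intJ intL by (simp add: eta3 integral_jacobian_apply)
  finally have "v \<bullet> (A *v Ds + (\<integral>z. L z \<theta>s l0 \<partial>F)) = 0" using root by simp
  then have vL: "v \<bullet> (\<integral>z. L z \<theta>s l0 \<partial>F) = 0" by (simp add: inner_add_right vA)
  \<comment> \<open>Only directions within radius \<open>r\<close> are treated, so that the points
    at step lengths at most 1 stay in the box. Linearity of \<open>P\<close> removes the restriction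
    later.\<close>
  have claim: "v \<bullet> fst (P (u, s, w)) = 0" if uw: "norm u \<le> r" "\<bar>s\<bar> \<le> r" "norm w \<le> r" for u s w
  proof -
    let ?t = "\<lambda>k. 1 / real (Suc k)"
    let ?q = "\<lambda>k z. real (Suc k) *\<^sub>R (\<phi> z (\<theta>s + ?t k *\<^sub>R u) (l0 + ?t k * s) - \<phi> z \<theta>s l0)"
    have t: "?t k > 0" "?t k \<le> 1" for k by auto
    have box: "\<theta>s + ?t k *\<^sub>R u \<in> cball \<theta>s r" "l0 + ?t k * s \<in> cball l0 r"
      "Ds + ?t k *\<^sub>R w \<in> cball Ds r" for k
      using mult_mono[OF t(2)[of k] uw(1)] mult_mono[OF t(2)[of k] uw(2)] mult_mono[OF t(2)[of k] uw(3)] r t(1)[of k]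
      by (auto simp: dist_norm abs_mult simp del: of_nat_Suc)
    have "(\<lambda>k. fst (real (Suc k) *\<^sub>R (Psi \<phi> \<psi> F ((\<theta>s, l0, Ds) + ?t k *\<^sub>R (u, s, w)) -
        Psi \<phi> \<psi> F (\<theta>s, l0, Ds)))) \<longlonglongrightarrow> fst (P (u, s, w))"
      by (intro tendsto_fst has_derivative_quotient_limit[OF P])
    moreover have "fst (real (Suc k) *\<^sub>R (Psi \<phi> \<psi> F ((\<theta>s, l0, Ds) + ?t k *\<^sub>R (u, s, w)) -
        Psi \<phi> \<psi> F (\<theta>s, l0, Ds))) = (\<integral>z. ?q k z \<partial>F)" for k
      by (simp only: add_Pair scaleR_Pair real_scaleR_def fst_scaleR fst_diff fst_Psi[OF box]
          fst_Psi[OF c] integral_scaleR_right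
          Bochner_Integration.integral_diff[OF integrable_phi[OF box(1,2)] integrable_phi[OF c(1,2)]])
    ultimately have 1: "(\<lambda>k. \<integral>z. ?q k z \<partial>F) \<longlonglongrightarrow> fst (P (u, s, w))" by simp
    \<comment> \<open>Differentiation under the integral sign: joint differentiability gives the
      pointwise limit, and \<open>phi_lipschitz\<close> gives a dominating multiple of
      \<open>m0\<close>, because the factor \<open>Suc k\<close> cancels the step length.\<close>
    have 2: "(\<lambda>k. \<integral>z. ?q k z \<partial>F) \<longlonglongrightarrow> (\<integral>z. J z \<theta>s l0 *v u + s *\<^sub>R L z \<theta>s l0 \<partial>F)"
    proof (rule integral_dominated_convergence[where w="\<lambda>z. (2 / r * norm u + cL * \<bar>s\<bar>) * m0 z"])
      show "AE z in F. (\<lambda>k. ?q k z) \<longlonglongrightarrow> J z \<theta>s l0 *v u + s *\<^sub>R L z \<theta>s l0"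
        using has_derivative_quotient_limit[OF has_derivative_jacobian_parameter(1)[OF smooth_phi], of _ \<theta>s l0 "(u, s)"]
        by simp
      show "AE z in F. norm (?q k z) \<le> (2 / r * norm u + cL * \<bar>s\<bar>) * m0 z" for k
      proof (rule AE_I2)
        fix z
        have "norm (?q k z) = real (Suc k) * norm (\<phi> z (\<theta>s + ?t k *\<^sub>R u) (l0 + ?t k * s) - \<phi> z \<theta>s l0)"
          by simp
        also have "\<dots> \<le> real (Suc k) * ((2 / r * norm (?t k *\<^sub>R u) + cL * \<bar>?t k * s\<bar>) * m0 z)"
          using phi_lipschitz[OF box(1)[of k] c(1) box(2)[of k] c(2), of z] by (intro mult_left_mono) auto
        also have "\<dots> = (2 / r * norm u + cL * \<bar>s\<bar>) * m0 z"
          by (simp add: abs_mult field_simps del: of_nat_Suc)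
        finally show "norm (?q k z) \<le> (2 / r * norm u + cL * \<bar>s\<bar>) * m0 z" .
      qed
    qed (use integrable_m0 in auto)
    have "fst (P (u, s, w)) = (\<integral>z. J z \<theta>s l0 *v u + s *\<^sub>R L z \<theta>s l0 \<partial>F)"
      by (rule LIMSEQ_unique[OF 1 2])
    also have "\<dots> = A *v u + s *\<^sub>R (\<integral>z. L z \<theta>s l0 \<partial>F)"
      using intJ intL by (simp add: integral_jacobian_apply)
    finally show ?thesis by (simp add: inner_add_right vA vL)
  qed
  \<comment> \<open>Surjectivity supplies a direction whose image has first block \<open>v\<close>.
    Scaled by \<open>r / (norm p + 1)\<close> it falls under the claim, which then says that a
    positive multiple of \<open>v \<bullet> v\<close> is zero.\<close>
  obtain p where p: "P p = (v, 0, 0)" using surj by (metis surjD)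
  define e where "e = r / (norm p + 1)"
  have e: "e > 0" using r by (auto simp: e_def intro!: divide_pos_pos add_nonneg_pos)
  obtain u s w where usw: "e *\<^sub>R p = (u, s, w)" by (cases "e *\<^sub>R p")
  have "norm (e *\<^sub>R p) = r * (norm p / (norm p + 1))" using e r by (simp add: e_def)
  also have "\<dots> \<le> r * 1" using r by (intro mult_left_mono) (auto simp: divide_simps add_nonneg_pos)
  finally have "norm (u, s, w) \<le> r" by (simp add: usw)
  then have "norm u \<le> r" "norm s \<le> r" "norm w \<le> r"
    using norm_fst_le[of u "(s, w)"] norm_snd_le[of "(s, w)" u] norm_fst_le[of s w] norm_snd_le[of w s]
    by auto
  with claim have "v \<bullet> fst (P (e *\<^sub>R p)) = 0" by (simp add: usw)
  then have "e * (v \<bullet> v) = 0"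
    using has_derivative_linear[OF P] by (simp add: linear_scale p)
  with e v show False by simp
qed

section \<open>Lipschitz dependence of the estimator on the tuning parameter\<close>

text \<open>The sample is frozen and its averages are assumed close to their means. The deviation
  \<open>1 / (2 * b)\<close> that the contraction tolerates is split evenly: one half for replacing
  the sample Jacobian at the centre by \<open>A\<close>, the other for moving \<theta> and
  \<open>l\<close> by at most \<rho> each.\<close>

lemma (in eta_box) sample_root_lipschitz:
  fixes x :: "nat \<Rightarrow> 'z" and n :: nat and t :: "real \<Rightarrow> real^'p"
  defines "h \<equiv> \<lambda>\<theta> l. (1 / real n) *\<^sub>R (\<Sum>i=1..n. \<phi> (x i) \<theta> l)"
  assumes n: "n \<ge> 1"
    and B: "linear B" "\<And>y. B (A *v y) = y" "inj B" "\<And>y. norm (B y) \<le> b * norm y" "b > 0"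
    and \<rho>: "\<rho> > 0" "\<rho> \<le> r" and \<sigma>: "\<sigma> \<ge> 0" "\<sigma> \<le> \<rho>"
    and J_close: "norm ((1 / real n) *\<^sub>R (\<Sum>i=1..n. J (x i) \<theta>s l0) - A) \<le> 1 / (4 * b)"
    and K0: "(1 / real n) * (\<Sum>i=1..n. m0 (x i)) \<le> K0" "K0 \<ge> 0"
    and K1: "(1 / real n) * (\<Sum>i=1..n. m1 (x i)) \<le> K1"
    and \<rho>K: "16 * b * C * K1 * \<rho> \<le> r"
    and start: "norm (h \<theta>s l0) \<le> \<rho> / (4 * b)"
    and \<sigma>K: "b * (cL * K0) * \<sigma> \<le> \<rho> / 4"
    and root: "\<And>\<theta> l. h \<theta> l = 0 \<longleftrightarrow> \<theta> = t l"
    and l: "\<bar>l - l0\<bar> \<le> \<sigma>"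
  shows "norm (t l - t l0) \<le> 2 * b * (cL * K0) * \<bar>l - l0\<bar>"
proof (rule root_lipschitz_in_parameter[where h=h and A="(*v) A" and B=B and \<rho>=\<rho> and \<sigma>=\<sigma>
      and ?x0.0=\<theta>s, OF B \<rho>(1) _ _ _ start \<sigma>K \<sigma>(1) root l])
  show "0 \<le> cL * K0" using cL_pos K0(2) by simp
  fix y k assume y: "y \<in> cball \<theta>s \<rho>" and k: "\<bar>k - l0\<bar> \<le> \<sigma>"
  then have yr: "y \<in> cball \<theta>s r" and kr: "k \<in> cball l0 r"
    using \<rho> \<sigma> by (auto simp: dist_real_def)
  have avg: "norm ((1 / real n) *\<^sub>R (\<Sum>i=1..n. f i)) \<le> c * ((1 / real n) * (\<Sum>i=1..n. m (x i)))"
    if "\<And>i. norm (f i) \<le> c * m (x i)" for f :: "nat \<Rightarrow> real^'p" and m :: "'z \<Rightarrow> real" and c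
  proof -
    have "norm (\<Sum>i=1..n. f i) \<le> (\<Sum>i=1..n. c * m (x i))"
      by (rule order_trans[OF norm_sum sum_mono[OF that]])
    then have "(1 / real n) * norm (\<Sum>i=1..n. f i) \<le> (1 / real n) * (\<Sum>i=1..n. c * m (x i))"
      by (rule mult_left_mono) simp
    then show ?thesis by (simp add: sum_distrib_left mult_ac)
  qed
  show "norm (h y k - h y l0) \<le> cL * K0 * \<bar>k - l0\<bar>"
  proof -
    have "norm ((1 / real n) *\<^sub>R (\<Sum>i=1..n. \<phi> (x i) y k - \<phi> (x i) y l0))
        \<le> (cL * \<bar>k - l0\<bar>) * ((1 / real n) * (\<Sum>i=1..n. m0 (x i)))"
      using phi_lipschitz[OF yr yr kr, of l0] r by (intro avg) auto
    also have "\<dots> \<le> (cL * \<bar>k - l0\<bar>) * K0"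
      using cL_pos by (intro mult_left_mono K0) auto
    finally show ?thesis by (simp add: h_def sum_subtractf scaleR_diff_right mult_ac)
  qed
  fix y' assume y': "y' \<in> cball \<theta>s \<rho>"
  let ?J = "\<lambda>\<theta> l u. (1 / real n) *\<^sub>R (\<Sum>i=1..n. J (x i) \<theta> l *v u)"
  \<comment> \<open>With the linear model subtracted, the mean value inequality turns closeness of
    derivatives on the ball into the closeness of increments required of \<open>h\<close>.\<close>
  have "norm ((h y k - A *v y) - (h y' k - A *v y')) \<le> (1 / (2 * b)) * norm (y - y')"
  proof (rule differentiable_bound[OF convex_cball[of \<theta>s \<rho>]])
    fix z assume z: "z \<in> cball \<theta>s \<rho>"
    then have zr: "z \<in> cball \<theta>s r" using \<rho> by auto
    show "((\<lambda>\<theta>. h \<theta> k - A *v \<theta>) has_derivative (\<lambda>u. ?J z k u - A *v u)) (at z within cball \<theta>s \<rho>)"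
      unfolding h_def
      by (intro has_derivative_diff has_derivative_scaleR_right has_derivative_sum
          has_derivative_at_withinI[OF has_derivative_jacobian_parameter(2)[OF smooth_phi]]
          bounded_linear_imp_has_derivative matrix_vector_mul_bounded_linear)
    show "onorm (\<lambda>u. ?J z k u - A *v u) \<le> 1 / (2 * b)"
    proof (rule onorm_bound)
      fix u
      have "norm ((1 / real n) *\<^sub>R (\<Sum>i=1..n. J (x i) z k *v u - J (x i) \<theta>s l0 *v u))
          \<le> (2 * C / r * (norm (z - \<theta>s) + \<bar>k - l0\<bar>) * norm u) * ((1 / real n) * (\<Sum>i=1..n. m1 (x i)))"
        using jacobian_lipschitz[OF zr kr] by (intro avg) (simp add: mult_ac)
      also have "\<dots> \<le> (2 * C / r * (norm (z - \<theta>s) + \<bar>k - l0\<bar>) * norm u) * K1"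
        using C r by (intro mult_left_mono K1) auto
      also have "\<dots> \<le> (2 * C / r * (\<rho> + \<rho>) * norm u) * K1"
      proof -
        have "(1 / real n) * (\<Sum>i=1..n. m1 (x i)) \<ge> 0"
          by (intro mult_nonneg_nonneg sum_nonneg m1_nonneg) auto
        with K1 have "K1 \<ge> 0" by linarith
        moreover have "norm (z - \<theta>s) \<le> \<rho>" using z by (simp add: dist_norm norm_minus_commute)
        ultimately show ?thesis
          using C r k \<sigma> by (intro mult_right_mono mult_left_mono add_mono) auto
      qed
      \<comment> \<open>The origin of the 16: the condition
        \<open>4 * C * K1 * \<rho> / r \<le> 1 / (4 * b)\<close>, cleared of denominators.\<close>
      also have "\<dots> = (16 * b * C * K1 * \<rho>) * (norm u / (4 * b * r))"
        using B(5) r by (simp add: field_simps)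
      also have "\<dots> \<le> r * (norm u / (4 * b * r))"
        using B(5) r by (intro mult_right_mono \<rho>K) auto
      also have "\<dots> = 1 / (4 * b) * norm u" using r by simp
      finally have 1: "norm (?J z k u - ?J \<theta>s l0 u) \<le> 1 / (4 * b) * norm u"
        by (simp add: sum_subtractf scaleR_diff_right)
      have "?J \<theta>s l0 u - A *v u = ((1 / real n) *\<^sub>R (\<Sum>i=1..n. J (x i) \<theta>s l0) - A) *v u"
        by (simp add: matrix_vector_mult_diff_rdistrib scaleR_matrix_vector_assoc[symmetric]
            linear_sum[OF bounded_linear.linear[OF bounded_linear_apply]])
      also have "norm \<dots> \<le> 1 / (4 * b) * norm u"
        by (rule order_trans[OF norm_matrix_vector_mult_le mult_right_mono[OF J_close norm_ge_zero]])
      finally have 2: "norm (?J \<theta>s l0 u - A *v u) \<le> 1 / (4 * b) * norm u" .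
      have "norm (?J z k u - A *v u) \<le> norm (?J z k u - ?J \<theta>s l0 u) + norm (?J \<theta>s l0 u - A *v u)"
        using norm_triangle_ineq[of "?J z k u - ?J \<theta>s l0 u" "?J \<theta>s l0 u - A *v u"] by simp
      also have "\<dots> \<le> 1 / (4 * b) * norm u + 1 / (4 * b) * norm u" by (rule add_mono[OF 1 2])
      also have "\<dots> = 1 / (2 * b) * norm u" by (simp add: field_simps)
      finally show "norm (?J z k u - A *v u) \<le> 1 / (2 * b) * norm u" .
    qed (use B(5) in simp)
  qed (use y y' in auto)
  then show "norm (h y k - h y' k - A *v (y - y')) \<le> norm (y - y') / (2 * b)"
    by (simp add: matrix_vector_mult_diff_distrib algebra_simps)
qed

text \<open>The constant is built from means under \<open>F\<close>, hence is the same for every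
  \<open>n\<close>. The sample conditions of the deterministic bound can fail only on five events:
  \<open>E1\<close> to \<open>E4\<close> vanish by the weak law, and \<open>E5\<close> by
  consistency of \<open>lh\<close>.\<close>

lemma (in eta_box) estimator_lipschitz_in_parameter:
  fixes M :: "'w measure" and Z :: "nat \<Rightarrow> 'w \<Rightarrow> 'z"
    and \<theta>h :: "nat \<Rightarrow> 'w \<Rightarrow> real \<Rightarrow> real^'p" and lh :: "nat \<Rightarrow> 'w \<Rightarrow> real"
  assumes M: "prob_space M"
    and ind: "prob_space.indep_vars M (\<lambda>_. borel) Z {1..}"
    and distr: "\<And>i. i \<ge> 1 \<Longrightarrow> distr M borel (Z i) = F"
    and meas [measurable]: "\<And>n. (\<lambda>\<omega>. \<theta>h n \<omega> l0) \<in> borel_measurable M"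
      "\<And>n. (\<lambda>\<omega>. \<theta>h n \<omega> (lh n \<omega>)) \<in> borel_measurable M"
    and theta_hat: "\<And>n. n \<ge> 1 \<Longrightarrow> AE \<omega> in M. \<forall>l \<theta>.
      (1 / real n) *\<^sub>R (\<Sum>i=1..n. \<phi> (Z i \<omega>) \<theta> l) = 0 \<longleftrightarrow> \<theta> = \<theta>h n \<omega> l"
    and root: "Psi \<phi> \<psi> F (\<theta>s, l0, Ds) = 0"
    and P: "(Psi \<phi> \<psi> F has_derivative P) (at (\<theta>s, l0, Ds))" "surj P"
    and lh: "tendsto_in_prob M lh l0"
  shows "\<exists>K. (\<lambda>n. measure M {\<omega> \<in> space M.
    norm (\<theta>h n \<omega> (lh n \<omega>) - \<theta>h n \<omega> l0) > K * \<bar>lh n \<omega> - l0\<bar>}) \<longlonglongrightarrow> 0"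
proof -
  interpret prob_space M by fact
  have [measurable]: "lh n \<in> borel_measurable M" for n using lh by (auto simp: tendsto_in_prob_def)
  have Z [measurable]: "Z i \<in> borel_measurable M" if "i \<ge> 1" for i
    using ind that by (auto simp: indep_vars_def)
  have c: "\<theta>s \<in> cball \<theta>s r" "l0 \<in> cball l0 r" "Ds \<in> cball Ds r" using r by auto
  obtain A' where A': "A ** A' = mat 1" "A' ** A = mat 1"
    using invertible_jacobian[OF root P] by (auto simp: invertible_def)
  \<comment> \<open>The added one makes \<open>b\<close> positive even before anything is known
    about the norm of the inverse.\<close>
  define b where "b = norm A' + 1"
  have b: "b > 0" by (simp add: b_def add_nonneg_pos)
  have B: "linear ((*v) A')" "\<And>y. A' *v (A *v y) = y" "inj ((*v) A')"
    "\<And>y. norm (A' *v y) \<le> b * norm y"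
  proof -
    show "linear ((*v) A')" by simp
    show "A' *v (A *v y) = y" for y using A' by (simp add: matrix_vector_mul_assoc)
    show "inj ((*v) A')"
      by (rule inj_on_inverseI[where g="(*v) A"]) (use A' in \<open>simp add: matrix_vector_mul_assoc\<close>)
    show "norm (A' *v y) \<le> b * norm y" for y
      using norm_matrix_vector_mult_le[of A' y] norm_ge_zero[of y]
      unfolding b_def distrib_right by linarith
  qed
  \<comment> \<open>The added one is the deviation from the mean that is tolerated off
    \<open>E3\<close> and \<open>E4\<close>.\<close>
  define K0 where "K0 = (\<integral>z. m0 z \<partial>F) + 1"
  define K1 where "K1 = (\<integral>z. m1 z \<partial>F) + 1"
  have K0: "K0 > 0" unfolding K0_def by (intro add_nonneg_pos integral_nonneg) (auto simp: m0_nonneg)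
  have K1: "K1 > 0" unfolding K1_def by (intro add_nonneg_pos integral_nonneg) (auto simp: m1_nonneg)
  have g: "16 * b * C * K1 \<ge> 0" using b C K1 by simp
  \<comment> \<open>This solves \<open>16 * b * C * K1 * \<rho> + \<rho> = r\<close>; both summands
    are nonnegative, so each is at most \<open>r\<close>.\<close>
  define \<rho> where "\<rho> = r / (16 * b * C * K1 + 1)"
  have \<rho>: "\<rho> > 0" "\<rho> \<le> r" "16 * b * C * K1 * \<rho> \<le> r"
  proof -
    show "\<rho> > 0" using r g by (auto simp: \<rho>_def intro!: divide_pos_pos add_nonneg_pos)
    have "16 * b * C * K1 + 1 > 0" using g by linarith
    then have "\<rho> * (16 * b * C * K1 + 1) = r" by (simp add: \<rho>_def)
    then have *: "16 * b * C * K1 * \<rho> + \<rho> = r" by (simp add: algebra_simps)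
    then show "\<rho> \<le> r" "16 * b * C * K1 * \<rho> \<le> r"
      using mult_nonneg_nonneg[OF g, of \<rho>] \<open>\<rho> > 0\<close> by linarith+
  qed
  \<comment> \<open>The first entry keeps the parameter in the box; the second is the largest value
    that the radius budget of the contraction allows.\<close>
  define \<sigma> where "\<sigma> = min \<rho> (\<rho> / (4 * b * (cL * K0)))"
  have \<sigma>: "\<sigma> > 0" "\<sigma> \<le> \<rho>" "b * (cL * K0) * \<sigma> \<le> \<rho> / 4"
  proof -
    have pos: "b * (cL * K0) > 0" using b cL_pos K0 by simp
    have "\<rho> / (4 * b * (cL * K0)) > 0"
      using b cL_pos K0 by (intro divide_pos_pos mult_pos_pos \<rho>) auto
    then show "\<sigma> > 0" "\<sigma> \<le> \<rho>" using \<rho> by (auto simp: \<sigma>_def)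
    have "b * (cL * K0) * \<sigma> \<le> b * (cL * K0) * (\<rho> / (4 * b * (cL * K0)))"
      using pos by (intro mult_left_mono) (auto simp: \<sigma>_def)
    also have "\<dots> = \<rho> / 4" using b cL_pos K0 by simp
    finally show "b * (cL * K0) * \<sigma> \<le> \<rho> / 4" .
  qed
  \<comment> \<open>The first block of the root equation: \<open>\<theta>s\<close> solves the
    population equation at \<open>l0\<close>. Off \<open>E2\<close> the sample equation is then
    nearly solved there, which starts the Newton iteration.\<close>
  have phi0: "(\<integral>z. \<phi> z \<theta>s l0 \<partial>F) = 0"
    using fst_Psi[OF c] root by simp
  have sqJ: "integrable F (\<lambda>z. (norm (J z \<theta>s l0))\<^sup>2)"
    and sq\<phi>: "integrable F (\<lambda>z. (norm (\<phi> z \<theta>s l0))\<^sup>2)"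
  proof -
    have sq: "integrable F (\<lambda>z. (norm (f z))\<^sup>2)"
      if [measurable]: "f \<in> borel_measurable borel" and le: "\<And>z. norm (f z) \<le> k * m0 z"
      for f :: "'z \<Rightarrow> 'b::{second_countable_topology, real_normed_vector}" and k
    proof (rule Bochner_Integration.integrable_bound)
      show "integrable F (\<lambda>z. k\<^sup>2 * (m0 z)\<^sup>2)" using m0_sq by simp
      show "AE z in F. norm ((norm (f z))\<^sup>2) \<le> norm (k\<^sup>2 * (m0 z)\<^sup>2)"
        using power_mono[OF le norm_ge_zero, of _ 2] by (auto simp: power_mult_distrib)
    qed measurable
    show "integrable F (\<lambda>z. (norm (J z \<theta>s l0))\<^sup>2)"
      by (rule sq[OF measurable_jacobian norm_jacobian_le[OF c(1,2)]])
    show "integrable F (\<lambda>z. (norm (\<phi> z \<theta>s l0))\<^sup>2)"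
      by (rule sq[OF measurable_phi, of _ _ 1]) (use norm_phi_le[OF c(1,2)] in simp)
  qed
  define E1 where "E1 n = {\<omega> \<in> space M. norm ((1 / real n) *\<^sub>R (\<Sum>i=1..n. J (Z i \<omega>) \<theta>s l0)
      - (\<integral>z. J z \<theta>s l0 \<partial>F)) > 1 / (4 * b)}" for n
  define E2 where "E2 n = {\<omega> \<in> space M. norm ((1 / real n) *\<^sub>R (\<Sum>i=1..n. \<phi> (Z i \<omega>) \<theta>s l0)
      - (\<integral>z. \<phi> z \<theta>s l0 \<partial>F)) > \<rho> / (4 * b)}" for n
  define E3 where "E3 n = {\<omega> \<in> space M. \<bar>(1 / real n) * (\<Sum>i=1..n. m0 (Z i \<omega>))
      - (\<integral>z. m0 z \<partial>F)\<bar> > 1}" for n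
  define E4 where "E4 n = {\<omega> \<in> space M. \<bar>(1 / real n) * (\<Sum>i=1..n. m1 (Z i \<omega>))
      - (\<integral>z. m1 z \<partial>F)\<bar> > 1}" for n
  define E5 where "E5 n = {\<omega> \<in> space M. lh n \<omega> \<notin> ball l0 \<sigma>}" for n
  have sumJ: "(\<lambda>\<omega>. \<Sum>i=1..n. J (Z i \<omega>) \<theta>s l0) \<in> borel_measurable M"
    and sum\<phi>: "(\<lambda>\<omega>. \<Sum>i=1..n. \<phi> (Z i \<omega>) \<theta>s l0) \<in> borel_measurable M"
    and sum0: "(\<lambda>\<omega>. \<Sum>i=1..n. m0 (Z i \<omega>)) \<in> borel_measurable M"
    and sum1: "(\<lambda>\<omega>. \<Sum>i=1..n. m1 (Z i \<omega>)) \<in> borel_measurable M" for n :: nat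
    using measurable_compose[OF Z measurable_jacobian] measurable_compose[OF Z measurable_phi]
      measurable_compose[OF Z m0] measurable_compose[OF Z m1]
    by (auto intro!: borel_measurable_sum)
  have E1 [measurable]: "E1 n \<in> events" for n
    unfolding E1_def by (rule sets_norm_affine_gt[OF sumJ])
  have E2 [measurable]: "E2 n \<in> events" for n
    unfolding E2_def by (rule sets_norm_affine_gt[OF sum\<phi>])
  have E3 [measurable]: "E3 n \<in> events" for n
    using sets_norm_affine_gt[OF sum0, of "1 / real n" n] unfolding E3_def by simp
  have E4 [measurable]: "E4 n \<in> events" for n
    using sets_norm_affine_gt[OF sum1, of "1 / real n" n] unfolding E4_def by simp
  have E5 [measurable]: "E5 n \<in> events" for n
    unfolding E5_def mem_ball dist_real_def by measurable
  have "(\<lambda>n. prob (E1 n)) \<longlonglongrightarrow> 0"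
    unfolding E1_def by (rule weak_law[OF ind distr measurable_jacobian sqJ]) (use b in auto)
  moreover have "(\<lambda>n. prob (E2 n)) \<longlonglongrightarrow> 0"
    unfolding E2_def by (rule weak_law[OF ind distr measurable_phi sq\<phi>]) (use b \<rho> in auto)
  moreover have "(\<lambda>n. prob (E3 n)) \<longlonglongrightarrow> 0"
    unfolding E3_def by (rule weak_law_real[OF ind distr m0 m0_sq]) auto
  moreover have "(\<lambda>n. prob (E4 n)) \<longlonglongrightarrow> 0"
    unfolding E4_def by (rule weak_law_real[OF ind distr m1 m1_sq]) auto
  moreover have "(\<lambda>n. prob (E5 n)) \<longlonglongrightarrow> 0"
    unfolding E5_def by (rule tendsto_in_prob_outside[OF M lh]) (use \<sigma> in auto)
  ultimately have "(\<lambda>n. prob (E1 n) + prob (E2 n) + prob (E3 n) + prob (E4 n) + prob (E5 n)) \<longlonglongrightarrow> 0 + 0 + 0 + 0 + 0"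
    by (intro tendsto_add)
  then have lim: "(\<lambda>n. prob (E1 n) + prob (E2 n) + prob (E3 n) + prob (E4 n) + prob (E5 n)) \<longlonglongrightarrow> 0"
    by simp
  define K where "K = 2 * b * (cL * K0)"
  have "prob {\<omega> \<in> space M. norm (\<theta>h n \<omega> (lh n \<omega>) - \<theta>h n \<omega> l0) > K * \<bar>lh n \<omega> - l0\<bar>}
      \<le> prob (E1 n) + prob (E2 n) + prob (E3 n) + prob (E4 n) + prob (E5 n)" if n: "n \<ge> 1" for n
  proof -
    have "prob {\<omega> \<in> space M. norm (\<theta>h n \<omega> (lh n \<omega>) - \<theta>h n \<omega> l0) > K * \<bar>lh n \<omega> - l0\<bar>}
        \<le> prob (E1 n \<union> E2 n \<union> E3 n \<union> E4 n \<union> E5 n)"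
    proof (rule finite_measure_mono_AE)
      show "AE \<omega> in M. \<omega> \<in> {\<omega> \<in> space M. norm (\<theta>h n \<omega> (lh n \<omega>) - \<theta>h n \<omega> l0) > K * \<bar>lh n \<omega> - l0\<bar>}
          \<longrightarrow> \<omega> \<in> E1 n \<union> E2 n \<union> E3 n \<union> E4 n \<union> E5 n"
        using theta_hat[OF n] AE_space
      proof eventually_elim
        case (elim \<omega>)
        show ?case
        proof (intro impI, rule ccontr)
          assume large: "\<omega> \<in> {\<omega> \<in> space M. norm (\<theta>h n \<omega> (lh n \<omega>) - \<theta>h n \<omega> l0) > K * \<bar>lh n \<omega> - l0\<bar>}"
            and "\<omega> \<notin> E1 n \<union> E2 n \<union> E3 n \<union> E4 n \<union> E5 n"
          then have good: "\<omega> \<notin> E1 n" "\<omega> \<notin> E2 n" "\<omega> \<notin> E3 n" "\<omega> \<notin> E4 n" "\<omega> \<notin> E5 n" by auto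
          have "norm (\<theta>h n \<omega> (lh n \<omega>) - \<theta>h n \<omega> l0) \<le> 2 * b * (cL * K0) * \<bar>lh n \<omega> - l0\<bar>"
          proof (rule sample_root_lipschitz[OF n B b \<rho>(1,2) less_imp_le[OF \<sigma>(1)] \<sigma>(2)
                _ _ less_imp_le[OF K0] _ \<rho>(3) _ \<sigma>(3)])
            show "norm ((1 / real n) *\<^sub>R (\<Sum>i=1..n. J (Z i \<omega>) \<theta>s l0) - A) \<le> 1 / (4 * b)"
              using good(1) elim by (simp add: E1_def A_def not_less)
            show "norm ((1 / real n) *\<^sub>R (\<Sum>i=1..n. \<phi> (Z i \<omega>) \<theta>s l0)) \<le> \<rho> / (4 * b)"
              using good(2) elim by (simp add: E2_def phi0 not_less)
            show "(1 / real n) * (\<Sum>i=1..n. m0 (Z i \<omega>)) \<le> K0"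
              using good(3) elim by (simp add: E3_def K0_def not_less)
            show "(1 / real n) * (\<Sum>i=1..n. m1 (Z i \<omega>)) \<le> K1"
              using good(4) elim by (simp add: E4_def K1_def not_less)
            show "\<bar>lh n \<omega> - l0\<bar> \<le> \<sigma>"
              using good(5) elim by (simp add: E5_def dist_real_def abs_minus_commute)
            show "(1 / real n) *\<^sub>R (\<Sum>i=1..n. \<phi> (Z i \<omega>) \<theta> l) = 0 \<longleftrightarrow> \<theta> = \<theta>h n \<omega> l" for \<theta> l
              using elim by blast
          qed
          with large show False by (simp add: K_def)
        qed
      qed
    qed measurable
    also have "\<dots> \<le> prob (E1 n) + prob (E2 n) + prob (E3 n) + prob (E4 n) + prob (E5 n)"
      by (intro order_trans[OF measure_Un_le] add_mono order_refl) measurable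
    finally show ?thesis .
  qed
  then have "\<forall>\<^sub>F n in sequentially.
      norm (prob {\<omega> \<in> space M. norm (\<theta>h n \<omega> (lh n \<omega>) - \<theta>h n \<omega> l0) > K * \<bar>lh n \<omega> - l0\<bar>})
      \<le> prob (E1 n) + prob (E2 n) + prob (E3 n) + prob (E4 n) + prob (E5 n)"
    by (auto simp: eventually_sequentially intro!: exI[of _ 1])
  from Lim_null_comparison[OF this lim] show ?thesis by blast
qed

section \<open>Passing from the domination hypothesis to a box\<close>

text \<open>A product of balls is convex, so the mean value inequality turns the entrywise bounds
  \<open>m1\<close> into a Lipschitz bound; \<open>C\<close> is the dimension factor incurred in
  passing to the operator norm.\<close>

lemma eta_box_of_dominated:
  fixes \<phi> :: "'z::topological_space \<Rightarrow> real^'p \<Rightarrow> real \<Rightarrow> real^'p"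
  assumes "prob_space F" and sets: "sets F = sets borel"
    and "\<And>\<theta> l. (\<lambda>z. \<phi> z \<theta> l) \<in> borel_measurable borel"
    and "\<And>\<theta>. (\<lambda>z. \<psi> z \<theta>) \<in> borel_measurable borel"
    and "\<And>z \<theta> l. (\<lambda>(\<theta>, l). \<phi> z \<theta> l) differentiable (at (\<theta>, l))"
    and "\<And>z \<theta>. \<psi> z differentiable (at \<theta>)"
    and "eta_dominated \<phi> \<psi> F (\<theta>s, l0, Ds)"
  shows "\<exists>r C m0 m1. eta_box \<phi> \<psi> F \<theta>s Ds l0 r C m0 m1"
proof -
  obtain U m0 m1 where U: "open U" "(\<theta>s, l0, Ds) \<in> U"
    and m: "m0 \<in> borel_measurable F" "integrable F (\<lambda>z. (m0 z)\<^sup>2)"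
      "m1 \<in> borel_measurable F" "integrable F (\<lambda>z. (m1 z)\<^sup>2)"
    and dom: "\<And>z \<alpha>. \<alpha> \<in> U \<Longrightarrow> norm (eta \<phi> \<psi> z \<alpha>) \<le> m0 z"
      "\<And>z \<alpha>. \<alpha> \<in> U \<Longrightarrow> eta \<phi> \<psi> z differentiable (at \<alpha>)"
      "\<And>z \<alpha> b c. \<alpha> \<in> U \<Longrightarrow> b \<in> Basis \<Longrightarrow> c \<in> Basis \<Longrightarrow>
        \<bar>frechet_derivative (eta \<phi> \<psi> z) (at \<alpha>) b \<bullet> c\<bar> \<le> m1 z"
    using assms(7) unfolding eta_dominated_def by blast
  obtain e where e: "e > 0" "cball (\<theta>s, l0, Ds) e \<subseteq> U"
    using U by (auto simp: open_contains_cball)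
  \<comment> \<open>The norm of a triple is at most the sum of the norms of its three blocks, so
    three thirds stay within \<open>e\<close>.\<close>
  define r where "r = e / 3"
  define R where "R = cball \<theta>s r \<times> cball l0 r \<times> cball Ds r"
  have R: "R \<subseteq> U"
  proof
    fix \<alpha> assume "\<alpha> \<in> R"
    then obtain \<theta> l D where \<alpha>: "\<alpha> = (\<theta>, l, D)" "dist \<theta>s \<theta> \<le> r" "dist l0 l \<le> r" "dist Ds D \<le> r"
      by (auto simp: R_def)
    have "dist (\<theta>s, l0, Ds) \<alpha> = norm (\<theta>s - \<theta>, l0 - l, Ds - D)" by (simp add: \<alpha> dist_norm)
    also have "\<dots> \<le> norm (\<theta>s - \<theta>) + (norm (l0 - l) + norm (Ds - D))"
      by (intro order_trans[OF norm_Pair_le] add_left_mono norm_Pair_le)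
    also have "\<dots> \<le> e" using \<alpha> by (simp add: r_def dist_norm)
    finally show "\<alpha> \<in> U" using e by auto
  qed
  define C where "C = real (DIM((real^'p) \<times> real \<times> (real^'p)) * DIM((real^'p) \<times> real \<times> (real^'p)))"
  have m1_nonneg: "m1 z \<ge> 0" for z
  proof -
    obtain b :: "(real^'p) \<times> real \<times> (real^'p)" where "b \<in> Basis" using nonempty_Basis by blast
    from dom(3)[OF U(2) this this, of z] show ?thesis by linarith
  qed
  have lip: "norm (eta \<phi> \<psi> z \<alpha> - eta \<phi> \<psi> z \<beta>) \<le> C * m1 z * norm (\<alpha> - \<beta>)"
    if "\<alpha> \<in> R" "\<beta> \<in> R" for z \<alpha> \<beta>
  proof (rule differentiable_bound[OF _ _ _ that])
    show "convex R" unfolding R_def by (intro convex_Times convex_cball)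
    fix \<gamma> assume "\<gamma> \<in> R"
    then have \<gamma>: "\<gamma> \<in> U" using R by blast
    then have der: "(eta \<phi> \<psi> z has_derivative frechet_derivative (eta \<phi> \<psi> z) (at \<gamma>)) (at \<gamma>)"
      using dom(2) frechet_derivative_works by blast
    then show "(eta \<phi> \<psi> z has_derivative frechet_derivative (eta \<phi> \<psi> z) (at \<gamma>)) (at \<gamma> within R)"
      by (rule has_derivative_at_withinI)
    show "onorm (frechet_derivative (eta \<phi> \<psi> z) (at \<gamma>)) \<le> C * m1 z"
    proof (rule onorm_bound)
      show "0 \<le> C * m1 z" using m1_nonneg by (simp add: C_def)
      show "norm (frechet_derivative (eta \<phi> \<psi> z) (at \<gamma>) h) \<le> C * m1 z * norm h" for h
        unfolding C_def by (rule norm_linear_le_entries[OF has_derivative_linear[OF der] dom(3)[OF \<gamma>]])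
    qed
  qed
  have mb: "m0 \<in> borel_measurable borel" "m1 \<in> borel_measurable borel"
    using m measurable_cong_sets[OF sets refl, of borel] by auto
  have "eta_box \<phi> \<psi> F \<theta>s Ds l0 r C m0 m1"
  proof (rule eta_box.intro)
    show "r > 0" using e by (simp add: r_def)
    show "C \<ge> 0" by (simp add: C_def)
    fix z and \<theta> :: "real^'p" and l and D :: "real^'p"
    assume "\<theta> \<in> cball \<theta>s r" "l \<in> cball l0 r" "D \<in> cball Ds r"
    then have 1: "(\<theta>, l, D) \<in> R" by (simp add: R_def)
    with R show "norm (eta \<phi> \<psi> z (\<theta>, l, D)) \<le> m0 z" by (auto intro: dom)
    fix \<theta>' :: "real^'p" and l'
    assume "\<theta>' \<in> cball \<theta>s r" "l' \<in> cball l0 r"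
    with 1 have "(\<theta>', l', D) \<in> R" by (simp add: R_def)
    from lip[OF 1 this, of z]
    have "norm (eta \<phi> \<psi> z (\<theta>, l, D) - eta \<phi> \<psi> z (\<theta>', l', D))
        \<le> C * m1 z * norm (\<theta> - \<theta>', l - l', 0 :: real^'p)" by simp
    also have "\<dots> \<le> C * m1 z * (norm (\<theta> - \<theta>') + \<bar>l - l'\<bar>)"
      using m1_nonneg[of z] order_trans[OF norm_Pair_le add_left_mono[OF norm_Pair_le],
          of "\<theta> - \<theta>'" "l - l'" "0 :: real^'p"]
      by (intro mult_left_mono) (auto simp: C_def)
    finally show "norm (eta \<phi> \<psi> z (\<theta>, l, D) - eta \<phi> \<psi> z (\<theta>', l', D))
        \<le> C * m1 z * (norm (\<theta> - \<theta>') + \<bar>l - l'\<bar>)" .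
  qed (rule assms m mb m1_nonneg)+
  then show ?thesis by blast
qed

section \<open>The truncated estimator\<close>

theorem theorem2:
  fixes M :: "'w measure" and Q :: "'v measure"
    and F :: "(real^'d) measure"
    and Z :: "nat \<Rightarrow> 'w \<Rightarrow> real^'d"
    and \<phi> :: "real^'d \<Rightarrow> real^'p \<Rightarrow> real \<Rightarrow> real^'p"
    and \<psi> :: "real^'d \<Rightarrow> real^'p \<Rightarrow> real"
    and \<theta>h :: "nat \<Rightarrow> 'w \<Rightarrow> real \<Rightarrow> real^'p"
    and lh :: "nat \<Rightarrow> 'w \<Rightarrow> real"
    and \<alpha>0 :: "(real^'p) \<times> real \<times> (real^'p)"
    and l0 :: real
  assumes "prob_space M" and "prob_space Q"
    and iid: "prob_space.indep_vars M (\<lambda>_. borel) Z {1..}"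
             "\<And>i. i \<ge> 1 \<Longrightarrow> distr M borel (Z i) = F"
    and measurable_phi: "\<And>\<theta> l. (\<lambda>z. \<phi> z \<theta> l) \<in> borel_measurable borel"
    and measurable_psi: "\<And>\<theta>. (\<lambda>z. \<psi> z \<theta>) \<in> borel_measurable borel"
    and smooth_phi: "\<And>z \<theta> l. (\<lambda>(\<theta>, l). \<phi> z \<theta> l) differentiable (at (\<theta>, l))"
    and smooth_psi: "\<And>z \<theta>. \<psi> z differentiable (at \<theta>)"
    and measurable_theta: "\<And>n l. (\<lambda>\<omega>. \<theta>h n \<omega> l) \<in> borel_measurable M"
             "\<And>n. (\<lambda>\<omega>. \<theta>h n \<omega> (lh n \<omega>)) \<in> borel_measurable M"
    and measurable_lambda: "\<And>n. lh n \<in> borel_measurable M"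
    and theta_hat: "\<And>n. n \<ge> 1 \<Longrightarrow> AE \<omega> in M. \<forall>l \<theta>.
             (1 / real n) *\<^sub>R (\<Sum>i=1..n. \<phi> (Z i \<omega>) \<theta> l) = 0 \<longleftrightarrow> \<theta> = \<theta>h n \<omega> l"
    and smooth_TE: "\<And>n. n \<ge> 1 \<Longrightarrow> AE \<omega> in M. \<forall>l. TE \<psi> Z \<theta>h n \<omega> differentiable (at l)"
    and lambda_hat_min: "\<And>n. n \<ge> 1 \<Longrightarrow> AE \<omega> in M. \<forall>l.
             TE \<psi> Z \<theta>h n \<omega> (lh n \<omega>) \<le> TE \<psi> Z \<theta>h n \<omega> l"
    and lambda_hat_unique: "unique_TE_stationary M \<psi> Z \<theta>h lh"
    and alpha0_root: "integrable F (\<lambda>z. eta \<phi> \<psi> z \<alpha>0)" "Psi \<phi> \<psi> F \<alpha>0 = 0"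
    and alpha0_unique: "\<And>\<alpha>. integrable F (\<lambda>z. eta \<phi> \<psi> z \<alpha>) \<Longrightarrow> Psi \<phi> \<psi> F \<alpha> = 0 \<Longrightarrow> \<alpha> = \<alpha>0"
    and l0: "l0 = fst (snd \<alpha>0)"
    and Psi_regular: "C1_nonsingular_at (Psi \<phi> \<psi> F) \<alpha>0"
    and eta_bounds: "eta_dominated \<phi> \<psi> F \<alpha>0"
  shows
    "(\<forall>\<theta>0 N. tendsto_in_prob M lh l0 \<and> l0 < 0 \<and>
          (\<exists>V. centred_normal Q N V) \<and>
          tendsto_in_distr M (\<lambda>n \<omega>. sqrt (real n) *\<^sub>R (\<theta>h n \<omega> 0 - \<theta>0)) Q N \<longrightarrow>
          tendsto_in_prob M (\<lambda>n \<omega>. truncated \<theta>h n \<omega> (lh n \<omega>)) \<theta>0 \<and>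
          tendsto_in_distr M (\<lambda>n \<omega>. sqrt (real n) *\<^sub>R (truncated \<theta>h n \<omega> (lh n \<omega>) - \<theta>0)) Q N)
     \<and>
     (\<forall>\<theta>0 N. tendsto_in_prob M lh l0 \<and> l0 > 1 \<and>
          (\<exists>V. centred_normal Q N V) \<and>
          tendsto_in_distr M (\<lambda>n \<omega>. sqrt (real n) *\<^sub>R (\<theta>h n \<omega> 1 - \<theta>0)) Q N \<longrightarrow>
          tendsto_in_prob M (\<lambda>n \<omega>. truncated \<theta>h n \<omega> (lh n \<omega>)) \<theta>0 \<and>
          tendsto_in_distr M (\<lambda>n \<omega>. sqrt (real n) *\<^sub>R (truncated \<theta>h n \<omega> (lh n \<omega>) - \<theta>0)) Q N)
     \<and>
     (\<forall>\<theta>0 N1 N2 N3 V. tendsto_in_prob M lh l0 \<and> l0 = 0 \<and>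
          centred_normal Q (\<lambda>\<omega>. (N1 \<omega>, N2 \<omega>, N3 \<omega>)) V \<and>
          tendsto_in_distr M
            (\<lambda>n \<omega>. sqrt (real n) *\<^sub>R (\<theta>h n \<omega> (lh n \<omega>) - \<theta>0, \<theta>h n \<omega> 0 - \<theta>0, lh n \<omega>))
            Q (\<lambda>\<omega>. (N1 \<omega>, N2 \<omega>, N3 \<omega>)) \<longrightarrow>
          tendsto_in_prob M (\<lambda>n \<omega>. truncated \<theta>h n \<omega> (lh n \<omega>)) \<theta>0 \<and>
          tendsto_in_distr M (\<lambda>n \<omega>. sqrt (real n) *\<^sub>R (truncated \<theta>h n \<omega> (lh n \<omega>) - \<theta>0))
            Q (\<lambda>\<omega>. indicator {0..} (N3 \<omega>) *\<^sub>R N1 \<omega> + indicator {..<0} (N3 \<omega>) *\<^sub>R N2 \<omega>))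
     \<and>
     (\<forall>\<theta>0 N1 N2 N3 V. tendsto_in_prob M lh l0 \<and> l0 = 1 \<and>
          centred_normal Q (\<lambda>\<omega>. (N1 \<omega>, N2 \<omega>, N3 \<omega>)) V \<and>
          tendsto_in_distr M
            (\<lambda>n \<omega>. sqrt (real n) *\<^sub>R (\<theta>h n \<omega> (lh n \<omega>) - \<theta>0, \<theta>h n \<omega> 1 - \<theta>0, lh n \<omega> - 1))
            Q (\<lambda>\<omega>. (N1 \<omega>, N2 \<omega>, N3 \<omega>)) \<longrightarrow>
          tendsto_in_prob M (\<lambda>n \<omega>. truncated \<theta>h n \<omega> (lh n \<omega>)) \<theta>0 \<and>
          tendsto_in_distr M (\<lambda>n \<omega>. sqrt (real n) *\<^sub>R (truncated \<theta>h n \<omega> (lh n \<omega>) - \<theta>0))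
            Q (\<lambda>\<omega>. indicator {..0} (N3 \<omega>) *\<^sub>R N1 \<omega> + indicator {0<..} (N3 \<omega>) *\<^sub>R N2 \<omega>))"
proof -
  interpret prob_space M by fact
  obtain \<theta>s Ds where \<alpha>0: "\<alpha>0 = (\<theta>s, l0, Ds)" using l0 by (metis prod.collapse)
  have Z1: "Z 1 \<in> borel_measurable M" using iid(1) by (auto simp: indep_vars_def)
  have F: "prob_space F" using prob_space_distr[OF Z1] iid(2)[of 1] by simp
  have sets_F: "sets F = sets borel" using iid(2)[of 1] by (metis order_refl sets_distr)
  obtain r C m0 m1 where "eta_box \<phi> \<psi> F \<theta>s Ds l0 r C m0 m1"
    using eta_box_of_dominated[OF F sets_F measurable_phi measurable_psi smooth_phi smooth_psi]
      eta_bounds unfolding \<alpha>0 by blast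
  then interpret eta_box \<phi> \<psi> F \<theta>s Ds l0 r C m0 m1 .
  obtain P where P: "(Psi \<phi> \<psi> F has_derivative P) (at (\<theta>s, l0, Ds))" "surj P"
    using Psi_regular unfolding C1_nonsingular_at_def \<alpha>0 by (metis bij_is_surj)
  note [measurable] = measurable_theta measurable_lambda
  have T [measurable]: "(\<lambda>\<omega>. truncated \<theta>h n \<omega> (lh n \<omega>)) \<in> borel_measurable M" for n
    unfolding truncated_def by measurable
  have lipschitz: "\<exists>K. (\<lambda>n. measure M {\<omega> \<in> space M.
      norm (\<theta>h n \<omega> (lh n \<omega>) - \<theta>h n \<omega> l0) > K * \<bar>lh n \<omega> - l0\<bar>}) \<longlonglongrightarrow> 0"
    if "tendsto_in_prob M lh l0"
    using estimator_lipschitz_in_parameter[OF \<open>prob_space M\<close> iid measurable_theta theta_hat _ P that]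
      alpha0_root(2) unfolding \<alpha>0 by blast
  \<comment> \<open>Both sides scale by \<open>sqrt n\<close> and \<theta>0 cancels, so the same
    \<open>K\<close> serves. Only an inclusion of events is used, which also covers
    \<open>n = 0\<close>, where the scaled event is empty.\<close>
  have cone: "\<exists>K. (\<lambda>n. measure M {\<omega> \<in> space M.
      norm (sqrt (real n) *\<^sub>R (\<theta>h n \<omega> (lh n \<omega>) - \<theta>0) - sqrt (real n) *\<^sub>R (\<theta>h n \<omega> l0 - \<theta>0))
        > K * \<bar>sqrt (real n) * (lh n \<omega> - l0)\<bar>}) \<longlonglongrightarrow> 0"
    if conv: "tendsto_in_prob M lh l0" for \<theta>0
  proof -
    obtain K where K: "(\<lambda>n. measure M {\<omega> \<in> space M.
        norm (\<theta>h n \<omega> (lh n \<omega>) - \<theta>h n \<omega> l0) > K * \<bar>lh n \<omega> - l0\<bar>}) \<longlonglongrightarrow> 0"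
      using lipschitz[OF conv] by blast
    have "prob {\<omega> \<in> space M.
        norm (sqrt (real n) *\<^sub>R (\<theta>h n \<omega> (lh n \<omega>) - \<theta>0) - sqrt (real n) *\<^sub>R (\<theta>h n \<omega> l0 - \<theta>0))
          > K * \<bar>sqrt (real n) * (lh n \<omega> - l0)\<bar>}
      \<le> prob {\<omega> \<in> space M. norm (\<theta>h n \<omega> (lh n \<omega>) - \<theta>h n \<omega> l0) > K * \<bar>lh n \<omega> - l0\<bar>}" for n
    proof (rule finite_measure_mono)
      have eq: "norm (sqrt (real n) *\<^sub>R (\<theta>h n \<omega> (lh n \<omega>) - \<theta>0) - sqrt (real n) *\<^sub>R (\<theta>h n \<omega> l0 - \<theta>0)) =
          sqrt (real n) * norm (\<theta>h n \<omega> (lh n \<omega>) - \<theta>h n \<omega> l0)" for \<omega>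
        by (simp add: scaleR_diff_right[symmetric])
      have "K * \<bar>sqrt (real n) * (lh n \<omega> - l0)\<bar> = sqrt (real n) * (K * \<bar>lh n \<omega> - l0\<bar>)" for \<omega>
        by (simp add: abs_mult)
      then show "{\<omega> \<in> space M. norm (sqrt (real n) *\<^sub>R (\<theta>h n \<omega> (lh n \<omega>) - \<theta>0)
            - sqrt (real n) *\<^sub>R (\<theta>h n \<omega> l0 - \<theta>0)) > K * \<bar>sqrt (real n) * (lh n \<omega> - l0)\<bar>}
        \<subseteq> {\<omega> \<in> space M. norm (\<theta>h n \<omega> (lh n \<omega>) - \<theta>h n \<omega> l0) > K * \<bar>lh n \<omega> - l0\<bar>}"
        by (auto simp only: eq mult_less_cancel_left real_sqrt_ge_zero of_nat_0_le_iff simp_thms)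
    qed measurable
    then show ?thesis
      by (intro exI[of _ K] Lim_null_comparison[OF always_eventually K]) simp
  qed
  let ?T = "\<lambda>\<theta>0 n \<omega>. sqrt (real n) *\<^sub>R (truncated \<theta>h n \<omega> (lh n \<omega>) - \<theta>0)"
  \<comment> \<open>A limit law at rate \<open>sqrt n\<close> already implies consistency, so each
    of the four items reduces to its convergence in distribution.\<close>
  have consistent: "tendsto_in_prob M (\<lambda>n \<omega>. truncated \<theta>h n \<omega> (lh n \<omega>)) \<theta>0 \<and>
      tendsto_in_distr M (?T \<theta>0) Q N" if "tendsto_in_distr M (?T \<theta>0) Q N" for \<theta>0 N
    using tendsto_in_prob_of_root_n[OF \<open>prob_space M\<close> \<open>prob_space Q\<close> T that] that by blast
  have outside: "(\<lambda>n. prob {\<omega> \<in> space M. lh n \<omega> \<notin> S}) \<longlonglongrightarrow> 0"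
    if "tendsto_in_prob M lh l0" "open S" "l0 \<in> S" for S
    by (rule tendsto_in_prob_outside[OF \<open>prob_space M\<close> that])
  show ?thesis
  proof (rule conjI[OF _ conjI[OF _ conjI]]; intro allI impI; elim conjE exE; rule consistent)
    fix \<theta>0 N V
    assume conv: "tendsto_in_prob M lh l0" and neg: "l0 < 0"
      and lim: "tendsto_in_distr M (\<lambda>n \<omega>. sqrt (real n) *\<^sub>R (\<theta>h n \<omega> 0 - \<theta>0)) Q N"
    \<comment> \<open>On \<open>lh n \<omega> < 0\<close> the truncated estimator is
      \<open>\<theta>h n \<omega> 0\<close>, and the open half-line contains \<open>l0\<close>, so
      its complement has vanishing probability.\<close>
    show "tendsto_in_distr M (?T \<theta>0) Q N"
      by (rule tendsto_in_distr_cong_asymp[OF lim _ _ outside[OF conv open_lessThan[of 0]]])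
        (use neg in \<open>auto simp: truncated_def intro!: always_eventually\<close>)
  next
    fix \<theta>0 N V
    assume conv: "tendsto_in_prob M lh l0" and gt: "l0 > 1"
      and lim: "tendsto_in_distr M (\<lambda>n \<omega>. sqrt (real n) *\<^sub>R (\<theta>h n \<omega> 1 - \<theta>0)) Q N"
    show "tendsto_in_distr M (?T \<theta>0) Q N"
      by (rule tendsto_in_distr_cong_asymp[OF lim _ _ outside[OF conv open_greaterThan[of 1]]])
        (use gt in \<open>auto simp: truncated_def intro!: always_eventually\<close>)
  next
    fix \<theta>0 N1 N2 N3 V
    assume conv: "tendsto_in_prob M lh l0" and zero: "l0 = 0"
      and lim: "tendsto_in_distr M
        (\<lambda>n \<omega>. sqrt (real n) *\<^sub>R (\<theta>h n \<omega> (lh n \<omega>) - \<theta>0, \<theta>h n \<omega> 0 - \<theta>0, lh n \<omega>))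
        Q (\<lambda>\<omega>. (N1 \<omega>, N2 \<omega>, N3 \<omega>))"
    obtain K where K: "(\<lambda>n. prob {\<omega> \<in> space M.
        norm (sqrt (real n) *\<^sub>R (\<theta>h n \<omega> (lh n \<omega>) - \<theta>0) - sqrt (real n) *\<^sub>R (\<theta>h n \<omega> 0 - \<theta>0))
          > K * \<bar>sqrt (real n) * lh n \<omega>\<bar>}) \<longlonglongrightarrow> 0"
      using cone[OF conv, of \<theta>0] unfolding zero by auto
    show "tendsto_in_distr M (?T \<theta>0) Q
        (\<lambda>\<omega>. indicator {0..} (N3 \<omega>) *\<^sub>R N1 \<omega> + indicator {..<0} (N3 \<omega>) *\<^sub>R N2 \<omega>)"
    \<comment> \<open>The exceptional event is \<open>lh n \<omega> \<ge> 1\<close>, the remaining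
      branch of the truncation. Elsewhere the truncation is the switch in the sign of
      \<open>lh\<close>, with the tie \<open>lh n \<omega> = 0\<close> on the side of the endpoint;
      \<open>n > 0\<close> gives the scaled parameter the same sign.\<close>
    proof (rule tendsto_in_distr_switch[OF \<open>prob_space M\<close> \<open>prob_space Q\<close> _ K _ _
          outside[OF conv open_lessThan[of 1]]])
      show "\<forall>\<^sub>F n in sequentially. \<forall>\<omega>\<in>space M - {\<omega> \<in> space M. lh n \<omega> \<notin> {..<1}}.
          ?T \<theta>0 n \<omega> = (if sqrt (real n) * lh n \<omega> > 0 then sqrt (real n) *\<^sub>R (\<theta>h n \<omega> (lh n \<omega>) - \<theta>0)
            else sqrt (real n) *\<^sub>R (\<theta>h n \<omega> 0 - \<theta>0))"
        using eventually_gt_at_top[of 0]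
        by eventually_elim (auto simp: truncated_def zero_less_mult_iff)
    qed (use lim zero in \<open>simp_all add: scaleR_Pair\<close>)
  next
    fix \<theta>0 N1 N2 N3 V
    assume conv: "tendsto_in_prob M lh l0" and one: "l0 = 1"
      and lim: "tendsto_in_distr M
        (\<lambda>n \<omega>. sqrt (real n) *\<^sub>R (\<theta>h n \<omega> (lh n \<omega>) - \<theta>0, \<theta>h n \<omega> 1 - \<theta>0, lh n \<omega> - 1))
        Q (\<lambda>\<omega>. (N1 \<omega>, N2 \<omega>, N3 \<omega>))"
    obtain K where K: "(\<lambda>n. prob {\<omega> \<in> space M.
        norm (sqrt (real n) *\<^sub>R (\<theta>h n \<omega> (lh n \<omega>) - \<theta>0) - sqrt (real n) *\<^sub>R (\<theta>h n \<omega> 1 - \<theta>0))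
          > K * \<bar>- (sqrt (real n) * (lh n \<omega> - 1))\<bar>}) \<longlonglongrightarrow> 0"
      using cone[OF conv, of \<theta>0] unfolding one abs_minus_cancel by blast
    \<comment> \<open>Reflecting the third coordinate makes \<open>lh n \<omega> \<ge> 1\<close>,
      where the endpoint value is used, the nonpositive side of the switch, so the case of the lower
      endpoint can be reused.\<close>
    have "continuous_on UNIV (\<lambda>x :: (real^'p) \<times> (real^'p) \<times> real. (fst x, fst (snd x), - snd (snd x)))"
      by (intro continuous_intros)
    from tendsto_in_distr_continuous[OF lim this]
    have lim': "tendsto_in_distr M (\<lambda>n \<omega>. (sqrt (real n) *\<^sub>R (\<theta>h n \<omega> (lh n \<omega>) - \<theta>0),
          sqrt (real n) *\<^sub>R (\<theta>h n \<omega> 1 - \<theta>0), - (sqrt (real n) * (lh n \<omega> - 1))))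
        Q (\<lambda>\<omega>. (N1 \<omega>, N2 \<omega>, - N3 \<omega>))"
      by (simp add: scaleR_Pair)
    have "tendsto_in_distr M (?T \<theta>0) Q
        (\<lambda>\<omega>. indicator {0..} (- N3 \<omega>) *\<^sub>R N1 \<omega> + indicator {..<0} (- N3 \<omega>) *\<^sub>R N2 \<omega>)"
    proof (rule tendsto_in_distr_switch[OF \<open>prob_space M\<close> \<open>prob_space Q\<close> lim' K _ _
          outside[OF conv open_greaterThan[of 0]]])
      show "\<forall>\<^sub>F n in sequentially. \<forall>\<omega>\<in>space M - {\<omega> \<in> space M. lh n \<omega> \<notin> {0<..}}.
          ?T \<theta>0 n \<omega> = (if - (sqrt (real n) * (lh n \<omega> - 1)) > 0
            then sqrt (real n) *\<^sub>R (\<theta>h n \<omega> (lh n \<omega>) - \<theta>0)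
            else sqrt (real n) *\<^sub>R (\<theta>h n \<omega> 1 - \<theta>0))"
        using eventually_gt_at_top[of 0]
        by eventually_elim (auto simp: truncated_def mult_less_0_iff)
    qed (use one in simp_all)
    then show "tendsto_in_distr M (?T \<theta>0) Q
        (\<lambda>\<omega>. indicator {..0} (N3 \<omega>) *\<^sub>R N1 \<omega> + indicator {0<..} (N3 \<omega>) *\<^sub>R N2 \<omega>)"
      by (simp add: indicator_def)
  qed
qed

end
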